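(* Let $q$ be a prime power and let $n,k$ be positive integers with $n\geq 2k$. Let $\mathcal{A}\subseteq\{1,2,\ldots,k,n-k,\ldots,n-1\}$ with $\mathcal A\cap \{k,n-k\}\neq\emptyset$. Let $r$ be the integer with $n\equiv r\pmod k$ and $0\leq r<k$. If $k>\frac{q^r-1}{q-1}$, then $$A_q(n,\mathcal A)=\frac{q^n-q^{k+r}}{q^k-1}+1.$$
   Context: For integers $0<t_1<\cdots<t_s<n$, a flag of type $(t_1,\ldots,t_s)$ on $\mathbb F_q^n$ is a sequence $\mathcal F=(\mathcal F_1,\ldots,\mathcal F_s)$ of subspaces of $\mathbb F_q^n$ with $\dim\mathcal F_i=t_i$ and $\mathcal F_1\subsetneq\cdots\subsetneq\mathcal F_s$. The subspace distance is $d_S(\mathcal U,\mathcal V)=\dim\mathcal U+\dim\mathcal V-2\dim(\mathcal U\cap\mathcal V)$, and the flag distance is $d_f(\mathcal F,\mathcal F')=\sum_{i=1}^{s}d_S(\mathcal F_i,\mathcal F'_i)$. A flag code of type $(t_1,\ldots,t_s)$ is a nonempty set $\mathcal C$ of flags of this type; its minimum distance $d_f(\mathcal C)$ is the minimum of $d_f(\mathcal F,\mathcal F')$ over distinct $\mathcal F,\mathcal F'\in\mathcal C$. One always has $d_f(\mathcal C)\le d_{\max}$, where $$d_{\max}=2\Big(\sum_{t_i\leq \lfloor n/2\rfloor}t_i+\sum_{t_i> \lfloor n/2\rfloor}(n-t_i)\Big).$$ The code $\mathcal C$ is called an $(n,(t_1,\ldots,t_s))_q$ optimum distance flag code (ODFC)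 if $d_f(\mathcal C)=d_{\max}$. For $\mathcal A=\{t_1,\ldots,t_s\}$, $A_q(n,\mathcal A)$ denotes the maximum number of flags in an $(n,(t_1,\ldots,t_s))_q$-ODFC. *)

theory Defs
  imports "HOL-Analysis.Cartesian_Space" "HOL-Number_Theory.Cong"
begin

text \<open>
  The space \<open>F\<^sub>q\<^sup>n\<close> is \<open>'a ^ 'n\<close> with \<open>'a\<close> a finite field, \<open>q = CARD('a)\<close> and \<open>n = CARD('n)\<close>.
  A flag is the list of its subspaces and its type is the list of their dimensions, so the
  \<open>i\<close>-th component of the mathematical text is the entry with index \<open>i - 1\<close>.
\<close>

definition flag_type :: "nat \<Rightarrow> nat list \<Rightarrow> bool" where
  "flag_type n ts \<longleftrightarrow> sorted_wrt (<) ts \<and> (\<forall>t\<in>set ts. 0 < t \<and> t < n)"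

definition is_flag :: "nat list \<Rightarrow> ('a::field ^ 'n) set list \<Rightarrow> bool" where
  "is_flag ts F \<longleftrightarrow>
     flag_type CARD('n) ts \<and> length F = length ts \<and>
     (\<forall>i<length ts. vec.subspace (F ! i) \<and> vec.dim (F ! i) = ts ! i) \<and>
     sorted_wrt (\<subset>) F"

definition subspace_dist :: "('a::field ^ 'n) set \<Rightarrow> ('a ^ 'n) set \<Rightarrow> int" where
  "subspace_dist U V = int (vec.dim U) + int (vec.dim V) - 2 * int (vec.dim (U \<inter> V))"

definition flag_dist :: "('a::field ^ 'n) set list \<Rightarrow> ('a ^ 'n) set list \<Rightarrow> int" where
  "flag_dist F F' = (\<Sum>i<length F. subspace_dist (F ! i) (F' ! i))"

definition flag_code :: "nat list \<Rightarrow> ('a::field ^ 'n) set list set \<Rightarrow> bool" where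
  "flag_code ts C \<longleftrightarrow> C \<noteq> {} \<and> (\<forall>F\<in>C. is_flag ts F)"

text \<open>
  A code with a single flag has no pair of distinct flags; its minimum distance is set to \<open>0\<close>
  by convention.
\<close>

definition code_min_dist :: "('a::field ^ 'n) set list set \<Rightarrow> int" where
  "code_min_dist C =
     (if \<exists>F\<in>C. \<exists>F'\<in>C. F \<noteq> F'
      then Min {flag_dist F F' |F F'. F \<in> C \<and> F' \<in> C \<and> F \<noteq> F'} else 0)"

definition max_flag_dist :: "nat \<Rightarrow> nat list \<Rightarrow> nat" where
  "max_flag_dist n ts =
     2 * ((\<Sum>t \<in> {t \<in> set ts. t \<le> n div 2}. t) + (\<Sum>t \<in> {t \<in> set ts. t > n div 2}. n - t))"

definition odfc :: "nat list \<Rightarrow> ('a::field ^ 'n) set list set \<Rightarrow> bool" where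
  "odfc ts C \<longleftrightarrow> flag_code ts C \<and> code_min_dist C = int (max_flag_dist CARD('n) ts)"

text \<open>
  The number \<open>A\<^sub>q(n, A)\<close>. The field and the index type enter through the two type arguments.
\<close>

definition max_odfc_card :: "'a::{field,finite} itself \<Rightarrow> 'n::finite itself \<Rightarrow> nat set \<Rightarrow> nat" where
  "max_odfc_card _ _ A =
     Max {card C |C :: ('a ^ 'n) set list set. odfc (sorted_list_of_set A) C}"

lemma finite_flags: "finite {F :: ('a::{field,finite} ^ 'n::finite) set list. is_flag ts F}"
  by (rule finite_subset[OF _ finite_lists_length_eq[of UNIV "length ts"]])
    (auto simp: is_flag_def)

lemma finite_odfc_cards:
  "finite {card C |C :: ('a::{field,finite} ^ 'n::finite) set list set. odfc ts C}"
proof -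
  have "{C :: ('a ^ 'n) set list set. odfc ts C} \<subseteq> Pow {F. is_flag ts F}"
    by (auto simp: odfc_def flag_code_def)
  then have "finite {C :: ('a ^ 'n) set list set. odfc ts C}"
    by (rule finite_subset) (simp add: finite_flags)
  then show ?thesis
    by (simp add: setcompr_eq_image)
qed

end

theory Submission
  imports Defs "HOL-Algebra.Algebraic_Closure_Type"
begin

text \<open>
  In a code of maximal distance any two distinct flags are at maximal distance in every component.
  Hence the components of dimension \<open>k\<close> are pairwise disjoint, and so are the orthogonal spaces of
  the components of dimension \<open>n - k\<close>. Either way the size is at most that of a partial
  \<open>k\<close>-spread, which is bounded by the hyperplane averaging argument of Nastase and Sissokho.

  Conversely, it suffices to find the right number of pairs \<open>U \<subseteq> V\<close> of dimensions \<open>k\<close> and \<open>n - k\<close>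
  such that the \<open>U\<close> are pairwise disjoint and any two of the \<open>V\<close> span the whole space, since each pair
  extends to a full flag arbitrarily. Such pairs are built by induction on \<open>n\<close>, in steps of \<open>k\<close>,
  from the multiplications in the field with \<open>q\<^bsup>n-k\<^esup>\<close> elements.
\<close>

section \<open>Finite vector spaces and spread sets\<close>

text \<open>The number in the theorem is L + 1 with L = q^(k+r) + q^(2k+r) + ... + q^(n-k), one
  summand for each inductive step. Multiplications by nonzero elements account for all but one of
  the pairs that a step adds; splitting one old pair into two supplies the last. The difficulty is
  the nesting: the k-spaces and the (n-k)-spaces must be extremal at the same time and fit together
  in one pairing. The other dimensions take care of themselves, since subspaces of disjoint spaces
  are disjoint and spaces above a spanning pair still span. The condition on k counts hyperplane
  sections. There is room for k - 1 of them, each lowers by at least 1 a constant that starts at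
  (q^r - 1)/(q - 1), and the contradiction comes as soon as this constant is at most 0.\<close>

lemma card_span:
  fixes scale :: "'a::{field,finite} \<Rightarrow> 'b::ab_group_add \<Rightarrow> 'b"
  assumes "vector_space scale" "finite B" "\<not> module.dependent scale B"
  shows "card (module.span scale B) = CARD('a) ^ card B \<and> finite (module.span scale B)"
  using assms(2,3)
proof (induction B)
  case empty
  interpret vector_space scale by fact
  show ?case by simp
next
  case (insert b B)
  interpret vector_space scale by fact
  have b: "b \<notin> span B" "independent B"
    using insert by (simp_all add: independent_insert)
  have inj: "inj_on (\<lambda>(c, s). scale c b + s) (UNIV \<times> span B)"
  proof (rule inj_onI, clarify)
    fix c s d t
    assume st: "s \<in> span B" "t \<in> span B" and eq: "scale c b + s = scale d b + t"
    have "c = d"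
    proof (rule ccontr)
      assume "c \<noteq> d"
      have "scale (c - d) b = t - s"
        using eq by (simp add: scale_left_diff_distrib algebra_simps)
      then have "scale (c - d) b \<in> span B"
        using st by (simp add: span_diff)
      then have "scale (inverse (c - d)) (scale (c - d) b) \<in> span B"
        by (rule span_scale)
      then show False
        using \<open>c \<noteq> d\<close> b by simp
    qed
    then show "c = d \<and> s = t" using eq by simp
  qed
  have im: "(\<lambda>(c, s). scale c b + s) ` (UNIV \<times> span B) = span (insert b B)"
    unfolding span_insert
  proof (intro equalityI subsetI)
    fix x assume "x \<in> {x. \<exists>k. x - scale k b \<in> span B}"
    then obtain k where "x - scale k b \<in> span B" by auto
    then show "x \<in> (\<lambda>(c, s). scale c b + s) ` (UNIV \<times> span B)"
      by (intro image_eqI[of _ _ "(k, x - scale k b)"]) auto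
  next
    fix x assume "x \<in> (\<lambda>(c, s). scale c b + s) ` (UNIV \<times> span B)"
    then obtain c s where "x = scale c b + s" "s \<in> span B" by auto
    then show "x \<in> {x. \<exists>k. x - scale k b \<in> span B}" by (auto intro!: exI[of _ c])
  qed
  have IH: "card (span B) = CARD('a) ^ card B" "finite (span B)"
    using insert b by auto
  have "card (span (insert b B)) = card ((UNIV :: 'a set) \<times> span B)"
    using card_image[OF inj] im by simp
  moreover have "finite (span (insert b B))"
    using IH unfolding im[symmetric] by (intro finite_imageI finite_cartesian_product) auto
  ultimately show ?case
    using IH insert(1,2) by (simp add: card_cartesian_product)
qed

lemma card_field_gt_1: "CARD('a::{field,finite}) > 1"
proof -
  have "card {0, 1 :: 'a} \<le> CARD('a)" by (rule card_mono) auto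
  then show ?thesis by simp
qed

lemma card_subspace:
  fixes U :: "('a::{field,finite} ^ 'n) set"
  assumes "vec.subspace U"
  shows "card U = CARD('a) ^ vec.dim U"
proof -
  obtain B where B: "B \<subseteq> U" "vec.independent B" "U \<subseteq> vec.span B" "card B = vec.dim U"
    using vec.basis_exists by blast
  have "vec.span B = U"
    using B assms vec.span_subspace by blast
  then show ?thesis
    using card_span[of "(*s)" B] B vec.vector_space_axioms vec.finiteI_independent by metis
qed

section \<open>Finite fields as fixed points of Frobenius powers\<close>

lemma power_card_field:
  fixes x :: "'a::{field,finite}"
  shows "x ^ CARD('a) = x"
proof (cases "x = 0")
  case False
  let ?P = "\<Prod>(UNIV - {0 :: 'a})"
  \<comment> \<open>Multiplication by \<open>x\<close> permutes the nonzero elements and so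
    preserves their product.\<close>
  have "(\<Prod>y\<in>UNIV - {0}. x * y) = ?P"
    by (rule prod.reindex_bij_witness[of _ "\<lambda>y. y / x" "\<lambda>y. x * y"]) (use False in auto)
  moreover have "(\<Prod>y\<in>UNIV - {0}. x * y) = x ^ (CARD('a) - 1) * ?P"
    by (simp add: prod.distrib)
  ultimately have "x ^ (CARD('a) - 1) = 1" by simp
  then have "x ^ Suc (CARD('a) - 1) = x" by (simp only: power_Suc mult_1_right)
  moreover have "Suc (CARD('a) - 1) = CARD('a)"
    using card_field_gt_1[where 'a = 'a] by simp
  ultimately show ?thesis by (simp only:)
qed (use card_field_gt_1[where 'a = 'a] in simp)

lemma of_nat_card_field: "of_nat CARD('a) = (0 :: 'a::{field,finite})"
proof -
  \<comment> \<open>Translation by 1 permutes the field, yet it adds 1 to the sum once for each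
    element.\<close>
  have "(\<Sum>x\<in>UNIV. x + 1 :: 'a) = (\<Sum>x\<in>UNIV. x)"
    by (rule sum.reindex_bij_witness[of _ "\<lambda>y. y - 1" "\<lambda>y. y + 1"]) auto
  then show ?thesis by (simp add: sum.distrib)
qed

text \<open>
  The polynomial \<open>(X + 1)\<^sup>q - X\<^sup>q - 1\<close> has degree less than \<open>q\<close> and vanishes on all of \<open>F\<^sub>q\<close>, so it
  is zero. This replaces the usual argument, which needs that \<open>q\<close> is a power of the
  characteristic.
\<close>

lemma freshman_alg_closure:
  fixes x y :: "'a::{field,finite} alg_closure"
  shows "(x + y) ^ CARD('a) = x ^ CARD('a) + y ^ CARD('a)"
proof -
  let ?q = "CARD('a)"
  have q: "?q > 1" by (rule card_field_gt_1)
  define p :: "'a poly" where "p = [:1, 1:] ^ ?q - monom 1 ?q - 1"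
  have "p = 0"
  proof (rule ccontr)
    assume "p \<noteq> 0"
    have m: "coeff ([:1, 1:] ^ ?q :: 'a poly) ?q = 1" by (rule coeff_linear_power)
    have d: "degree ([:1, 1:] ^ ?q :: 'a poly) = ?q"
      by (rule degree_linear_power)
    have "degree p < ?q"
    proof (rule degree_lessI)
      show "\<forall>k\<ge>?q. coeff p k = 0"
      proof (intro allI impI)
        fix k assume "k \<ge> ?q"
        then show "coeff p k = 0"
          using q m d by (cases "k = ?q") (auto simp: p_def coeff_eq_0)
      qed
    qed (use q in auto)
    moreover have "poly p x = 0" for x
      by (simp add: p_def poly_monom power_card_field)
    then have "{x. poly p x = 0} = UNIV" by auto
    ultimately show False
      using card_poly_roots_bound[OF \<open>p \<noteq> 0\<close>] by simp
  qed
  \<comment> \<open>The root count takes place over \<open>'a\<close>. As an identity of polynomials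
    its result carries over to the closure, where it can be evaluated at any point.\<close>
  moreover have "map_poly to_ac p = [:1, 1:] ^ ?q - monom 1 ?q - 1"
  proof -
    have h: "map_poly to_ac (u * v) = map_poly to_ac u * map_poly to_ac v" for u v :: "'a poly"
      by (rule poly_eqI) (simp add: coeff_map_poly coeff_mult to_ac_sum)
    have h1: "map_poly to_ac (u - v) = map_poly to_ac u - map_poly to_ac v" for u v :: "'a poly"
      by (rule poly_eqI) (simp add: coeff_map_poly)
    have pw: "map_poly to_ac (u ^ m) = map_poly to_ac u ^ m" for u :: "'a poly" and m
      by (induction m) (simp_all add: h map_poly_1)
    have "map_poly to_ac [:1, 1 :: 'a:] = [:1, 1:]" "map_poly to_ac (1 :: 'a poly) = 1"
      "map_poly to_ac (monom (1 :: 'a) ?q) = monom 1 ?q"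
      by (simp_all add: map_poly_pCons map_poly_1 map_poly_monom)
    then show ?thesis
      by (simp only: p_def h1 pw)
  qed
  ultimately have id: "[:1, 1:] ^ ?q - monom 1 ?q - 1 = (0 :: 'a alg_closure poly)"
    by simp
  have t: "(t + 1) ^ ?q = t ^ ?q + 1" for t :: "'a alg_closure"
    using arg_cong[OF id, of "\<lambda>u. poly u t"] by (simp add: poly_monom algebra_simps)
  show ?thesis
  \<comment> \<open>Homogenise: for nonzero \<open>y\<close> put \<open>t = x / y\<close>.\<close>
  proof (cases "y = 0")
    case False
    have "x + y = (x / y + 1) * y" using False by (simp add: field_simps)
    then have "(x + y) ^ ?q = (x / y + 1) ^ ?q * y ^ ?q" by (simp only: power_mult_distrib)
    also have "\<dots> = x ^ ?q + y ^ ?q"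
      unfolding t power_divide using False by (simp add: distrib_right)
    finally show ?thesis .
  qed (use q in simp)
qed

text \<open>For \<open>N > 0\<close> this is the subfield with q^N elements, as the fixed points of
  the N-th power of Frobenius.\<close>

definition ext_field :: "nat \<Rightarrow> 'a::{field,finite} alg_closure set" where
  "ext_field N = {x. x ^ (CARD('a) ^ N) = x}"

lemma ext_field_add:
  assumes "x \<in> ext_field N" "y \<in> ext_field N"
  shows "x + y \<in> (ext_field N :: 'a::{field,finite} alg_closure set)"
proof -
  have "(x + y) ^ (CARD('a) ^ N) = x ^ (CARD('a) ^ N) + y ^ (CARD('a) ^ N)" for x y :: "'a alg_closure"
    by (induction N arbitrary: x y) (simp_all add: power_mult freshman_alg_closure)
  then show ?thesis using assms by (simp add: ext_field_def)
qed

lemma ext_field_to_ac: "to_ac c \<in> ext_field N"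
proof -
  have "c ^ (CARD('a) ^ N) = c" for c :: 'a
    by (induction N) (simp_all add: power_mult power_card_field)
  then show ?thesis by (simp add: ext_field_def flip: to_ac_power)
qed

lemma ext_field_mult: "x \<in> ext_field N \<Longrightarrow> y \<in> ext_field N \<Longrightarrow> x * y \<in> ext_field N"
  by (simp add: ext_field_def power_mult_distrib)

lemma ext_field_diff:
  assumes "x \<in> ext_field N" "y \<in> ext_field N"
  shows "x - y \<in> ext_field N"
  using ext_field_add[OF assms(1) ext_field_mult[OF ext_field_to_ac[of "-1"] assms(2)]] by simp

text \<open>The elements are the roots of X^Q - X with Q = q^N, which splits over the closure. Its
  derivative is the constant -1 because Q vanishes in characteristic p, so no root is double and
  there are exactly Q of them.\<close>

lemma card_ext_field:
  assumes "N > 0"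
  shows "card (ext_field N :: 'a::{field,finite} alg_closure set) = CARD('a) ^ N"
proof -
  let ?Q = "CARD('a) ^ N"
  define p :: "'a alg_closure poly" where "p = monom 1 ?Q - monom 1 1"
  have Q: "?Q > 1" using assms card_field_gt_1[where 'a = 'a] by (intro one_less_power)
  have deg: "degree p = ?Q"
    using Q degree_add_eq_left[of "- monom 1 1" "monom 1 ?Q :: 'a alg_closure poly"]
    by (simp add: p_def degree_monom_eq)
  have "p \<noteq> 0" using deg Q by auto
  have "of_nat ?Q = (0 :: 'a alg_closure)"
    using assms of_nat_card_field[where 'a = 'a] by (metis power_eq_0_iff of_nat_power to_ac_0 to_ac_of_nat)
  then have pd: "pderiv p = -1"
    unfolding p_def pderiv_diff pderiv_monom by (simp only: monom_0 monom_eq_0) (simp add: one_pCons monom_0)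
  obtain A c where A: "size A = degree p" "p = smult c (\<Prod>x\<in>#A. [:-x, 1:])"
    using alg_closed_imp_factorization[OF \<open>p \<noteq> 0\<close>] by blast
  have "c \<noteq> 0" using A(2) \<open>p \<noteq> 0\<close> by auto
  have roots: "set_mset A = ext_field N"
  proof -
    have "poly p x = 0 \<longleftrightarrow> x \<in># A" for x
      using \<open>c \<noteq> 0\<close> by (subst A(2)) (auto simp: poly_prod_mset prod_mset_zero_iff)
    then have "set_mset A = {x. poly p x = 0}" by auto
    also have "\<dots> = ext_field N"
      by (simp add: p_def ext_field_def poly_monom)
    finally show ?thesis .
  qed
  have "count A x = 1" if "x \<in># A" for x
  proof (rule ccontr)
    assume "count A x \<noteq> 1"
    then have "count A x > 1" using that count_greater_zero_iff[of A x] by linarith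
    then have "count (A - {#x#}) x > 0" by simp
    then have x2: "x \<in># A - {#x#}" by (simp only: count_greater_zero_iff)
    define A' where "A' = A - {#x#} - {#x#}"
    have "A = add_mset x (add_mset x A')"
      unfolding A'_def insert_DiffM[OF x2] insert_DiffM[OF that] ..
    then have "(\<Prod>x\<in>#A. [:-x, 1:]) = [:-x, 1:] * ([:-x, 1:] * (\<Prod>x\<in>#A'. [:-x, 1:]))"
      by simp
    then have "p = smult c ([:-x, 1:] * ([:-x, 1:] * (\<Prod>x\<in>#A'. [:-x, 1:])))"
      using A(2) by (rule subst)
    then have "p = [:-x, 1:] * ([:-x, 1:] * smult c (\<Prod>x\<in>#A'. [:-x, 1:]))"
      unfolding mult_smult_right .
    then obtain u where u: "p = [:-x, 1:] * ([:-x, 1:] * u)" by (rule that)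
    have "poly (pderiv p) x = 0"
      unfolding u pderiv_mult poly_add poly_mult by simp
    then show False by (simp add: pd)
  qed
  then have "size A = card (set_mset A)"
    by (simp add: size_multiset_overloaded_eq)
  then show ?thesis using A(1) deg roots by simp
qed

text \<open>Identify \<open>H\<close> with the field of q^N elements, an N-dimensional space over
  \<open>'a\<close>, and take the multiplications by its nonzero elements. The difference of two
  multiplications is again one, by a nonzero element, hence injective. The maps are linear on the
  whole space, but only their restrictions to \<open>H\<close> are controlled.\<close>

lemma spread_set_exists:
  fixes H :: "('a::{field,finite} ^ 'n::finite) set"
  assumes H: "vec.subspace H" and N: "vec.dim H = N" "N > 0"
  obtains M :: "('a ^ 'n \<Rightarrow> 'a ^ 'n) set"
  where "finite M" "card M = CARD('a) ^ N - 1"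
    "\<forall>f\<in>M. Vector_Spaces.linear (*s) (*s) f \<and> f ` H = H \<and> inj_on f H"
    "\<forall>f\<in>M. \<forall>g\<in>M. f \<noteq> g \<longrightarrow> inj_on (\<lambda>x. f x - g x) H"
proof -
  define K :: "'a alg_closure set" where "K = ext_field N"
  \<comment> \<open>The closure as a vector space over \<open>'a\<close>. The scaling in
    \<open>card_span\<close> is a parameter so that it applies here as well as to
    \<open>'a ^ 'n\<close>.\<close>
  define sc where "sc = (\<lambda>(c :: 'a) (x :: 'a alg_closure). to_ac c * x)"
  interpret ac: vector_space sc
    by unfold_locales (simp_all add: sc_def algebra_simps)
  interpret p: vector_space_pair "(*s) :: 'a \<Rightarrow> 'a ^ 'n \<Rightarrow> 'a ^ 'n" sc
    by unfold_locales
  have K: "ac.subspace K"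
    using ext_field_to_ac[of 0] unfolding ac.subspace_def K_def
    by (auto simp: sc_def ext_field_add ext_field_mult ext_field_to_ac)
  have cK: "card K = CARD('a) ^ N"
    unfolding K_def by (rule card_ext_field[OF N(2)])
  have "finite K"
    using cK card_field_gt_1[where 'a = 'a] by (metis card.infinite not_one_less_zero power_not_zero)
  obtain C where C: "C \<subseteq> K" "ac.independent C" "K \<subseteq> ac.span C" "card C = ac.dim K"
    using ac.basis_exists by blast
  have fC: "finite C" using C(1) \<open>finite K\<close> finite_subset by blast
  have "ac.span C = K" using C K ac.span_subspace by blast
  then have "CARD('a) ^ card C = CARD('a) ^ N"
    using card_span[OF ac.vector_space_axioms fC C(2)] cK by simp
  then have dK: "ac.dim K = N"
    using C(4) card_field_gt_1[where 'a = 'a] by (simp add: power_inject_exp)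
  obtain B where B: "B \<subseteq> H" "vec.independent B" "H \<subseteq> vec.span B" "card B = vec.dim H"
    using vec.basis_exists by blast
  obtain \<psi> where psi: "Vector_Spaces.linear (*s) sc \<psi>" "\<psi> ` H = K" "inj_on \<psi> H"
    using p.finite_basis_to_basis_subspace_isomorphism[OF H K _ _ B fC C] dK N
      vec.finiteI_independent[OF B(2)] by auto
  interpret q: vector_space_pair sc "(*s) :: 'a \<Rightarrow> 'a ^ 'n \<Rightarrow> 'a ^ 'n"
    by unfold_locales
  obtain \<phi> where phi: "Vector_Spaces.linear sc (*s) \<phi>" "\<phi> ` K = H" "inj_on \<phi> K"
    using q.finite_basis_to_basis_subspace_isomorphism[OF K H _ fC C vec.finiteI_independent[OF B(2)] B]
      dK N by auto
  interpret psi: Vector_Spaces.linear "(*s)" sc \<psi> by fact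
  interpret phi: Vector_Spaces.linear sc "(*s)" \<phi> by fact
  define mu where "mu a = (\<lambda>x. \<phi> (a * \<psi> x))" for a
  have diff: "mu a x - mu b x = mu (a - b) x" for a b x
    by (simp add: mu_def algebra_simps phi.diff)
  have lin: "Vector_Spaces.linear (*s) (*s) (mu a)" for a
  proof -
    have "Vector_Spaces.linear sc sc (\<lambda>x. a * x)"
      by unfold_locales (simp_all add: sc_def algebra_simps)
    then show ?thesis
      unfolding mu_def using psi(1) phi(1)
      by unfold_locales (simp_all add: psi.add phi.add psi.scale phi.scale distrib_left
          mult.left_commute[of a] sc_def flip: phi.scale)
  qed
  have inj: "inj_on (mu a) H" if "a \<in> K" "a \<noteq> 0" for a
  proof (rule inj_onI)
    fix x y assume xy: "x \<in> H" "y \<in> H" "mu a x = mu a y"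
    then have "\<psi> x \<in> K" "\<psi> y \<in> K" using psi by auto
    then have "a * \<psi> x = a * \<psi> y"
      using xy(3) that phi(3) unfolding mu_def K_def by (meson ext_field_mult inj_onD)
    then show "x = y" using that xy psi(3) by (auto dest: inj_onD)
  qed
  have im: "mu a ` H = H" if "a \<in> K" "a \<noteq> 0" for a
  proof (rule endo_inj_surj)
    show "mu a ` H \<subseteq> H"
    proof
      fix y assume "y \<in> mu a ` H"
      then obtain x where x: "x \<in> H" "y = \<phi> (a * \<psi> x)" by (auto simp: mu_def)
      then have "a * \<psi> x \<in> K" using psi(2) that by (auto simp: K_def intro: ext_field_mult)
      then show "y \<in> H" using x(2) phi(2) by blast
    qed
  qed (use inj that in auto)
  have "inj_on mu (K - {0})"
  proof (rule inj_onI, rule ccontr)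
    fix a b assume ab: "a \<in> K - {0}" "b \<in> K - {0}" "mu a = mu b" "a \<noteq> b"
    have "a - b \<in> K" using ab by (auto simp: K_def ext_field_diff)
    then have "inj_on (mu (a - b)) H" using inj ab by auto
    moreover have "mu (a - b) x = 0" for x using ab diff[of a x b] by simp
    ultimately have "x = 0" if "x \<in> H" for x
      using that vec.subspace_0[OF H] by (auto dest: inj_onD)
    then have "H = {0}" using vec.subspace_0[OF H] by auto
    then show False using N by simp
  qed
  then have "card (mu ` (K - {0})) = CARD('a) ^ N - 1"
    using cK ac.subspace_0[OF K] by (simp add: card_image)
  moreover have "inj_on (\<lambda>x. f x - g x) H" if "f \<in> mu ` (K - {0})" "g \<in> mu ` (K - {0})" "f \<noteq> g" for f g
  proof -
    obtain a b where ab: "f = mu a" "g = mu b" "a \<in> K" "b \<in> K" "a \<noteq> b"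
      using \<open>f \<in> _\<close> \<open>g \<in> _\<close> \<open>f \<noteq> g\<close> by auto
    then have "a - b \<in> K" by (auto simp: K_def ext_field_diff)
    then show ?thesis using inj[of "a - b"] ab by (simp add: diff)
  qed
  moreover have "f ` H = H" "inj_on f H" "Vector_Spaces.linear (*s) (*s) f" if "f \<in> mu ` (K - {0})" for f
    using that im inj lin by blast+
  ultimately show thesis
    using that[of "mu ` (K - {0})"] \<open>finite K\<close> by blast
qed

section \<open>The upper bound for partial spreads\<close>

definition dot :: "'a::field ^ 'n \<Rightarrow> 'a ^ 'n \<Rightarrow> 'a" where
  "dot a x = (\<Sum>i\<in>UNIV. a $ i * x $ i)"

lemma dot_0 [simp]: "dot a 0 = 0" "dot 0 a = 0"
  by (simp_all add: dot_def)

lemma dot_add: "dot a (x + y) = dot a x + dot a y"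
  by (simp add: dot_def distrib_left sum.distrib)

lemma dot_scale: "dot a (c *s x) = c * dot a x"
  by (simp add: dot_def sum_distrib_left mult.left_commute)

lemma dot_commute: "dot a x = dot x a"
  by (simp add: dot_def mult.commute)

lemma subspace_dot_kernel: "vec.subspace {x. dot a x = 0}"
  by (auto simp: vec.subspace_def dot_add dot_scale)

lemma dot_nonzero:
  assumes "x \<noteq> (0 :: 'a::field ^ 'n::finite)"
  obtains y where "dot x y \<noteq> 0"
proof -
  obtain i where i: "x $ i \<noteq> 0" using assms by (auto simp: vec_eq_iff)
  have "dot x (axis i 1) = (\<Sum>j\<in>UNIV. if j = i then x $ j else 0)"
    unfolding dot_def by (rule sum.cong) (auto simp: axis_def)
  then have "dot x (axis i 1) = x $ i" by simp
  then show thesis using that i by metis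
qed

text \<open>\<open>E\<close> is the direct sum of the line through \<open>v\<close> and the section;
  the coefficient of \<open>v\<close> in \<open>x\<close> is
  \<open>dot a x / dot a v\<close>.\<close>

lemma card_hyperplane_section:
  fixes E :: "('a::{field,finite} ^ 'n::finite) set"
  assumes E: "vec.subspace E" and v: "v \<in> E" "dot a v \<noteq> 0"
  shows "CARD('a) * card (E \<inter> {x. dot a x = 0}) = card E"
proof -
  let ?K = "E \<inter> {x. dot a x = 0}"
  have "bij_betw (\<lambda>(c, x). c *s v + x) (UNIV \<times> ?K) E"
  proof (rule bij_betw_byWitness[where f' = "\<lambda>x. (dot a x / dot a v, x - (dot a x / dot a v) *s v)"])
    show "\<forall>p\<in>UNIV \<times> ?K. (case (case p of (c, x) \<Rightarrow> c *s v + x) of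
        x \<Rightarrow> (dot a x / dot a v, x - (dot a x / dot a v) *s v)) = p"
      using v by (auto simp: dot_add dot_scale)
    have "dot a (x - (dot a x / dot a v) *s v) = 0" for x
      using dot_add[of a "x - (dot a x / dot a v) *s v" "(dot a x / dot a v) *s v"] v
      by (simp add: dot_scale)
    then show "(\<lambda>x. (dot a x / dot a v, x - (dot a x / dot a v) *s v)) ` E \<subseteq> UNIV \<times> ?K"
      using E v by (auto intro: vec.subspace_diff vec.subspace_scale)
    show "(\<lambda>(c, x). c *s v + x) ` (UNIV \<times> ?K) \<subseteq> E"
      using E v by (auto intro: vec.subspace_add vec.subspace_scale)
  qed auto
  then have "card E = card ((UNIV :: 'a set) \<times> ?K)"
    by (metis bij_betw_same_card)
  then show ?thesis by (simp add: card_cartesian_product)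
qed

lemma card_dot_annihilator:
  fixes x :: "'a::{field,finite} ^ 'n::finite"
  assumes "x \<noteq> 0"
  shows "CARD('a) * card {a. dot a x = 0} = CARD('a) ^ CARD('n)"
proof -
  obtain y where "dot x y \<noteq> 0" using dot_nonzero[OF assms] .
  then have "CARD('a) * card (UNIV \<inter> {a. dot x a = 0}) = card (UNIV :: ('a ^ 'n) set)"
    by (intro card_hyperplane_section) (auto simp: vec.subspace_UNIV)
  then show ?thesis by (simp add: dot_commute[of _ x])
qed

text \<open>Vectors may be orthogonal to themselves, so \<open>perp U\<close> need not be a
  complement of \<open>U\<close>. What counts is its dimension, that it turns spanning into
  disjointness, and its reading as the set of linear forms vanishing on \<open>U\<close>.\<close>

definition perp :: "('a::field ^ 'n) set \<Rightarrow> ('a ^ 'n) set" where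
  "perp U = {a. \<forall>x\<in>U. dot a x = 0}"

lemma subspace_perp: "vec.subspace (perp U)"
  using subspace_dot_kernel
  by (auto simp: perp_def vec.subspace_def dot_add dot_scale dot_commute)

lemma zero_in_perp: "0 \<in> perp U"
  by (simp add: perp_def)

text \<open>Count the pairs \<open>(a, x)\<close> with \<open>dot a x = 0\<close> in both orders:
  each nonzero \<open>x\<close> has q^(n-1) partners. The factor q keeps the exponent n free of
  subtraction.\<close>

lemma double_count_dot:
  fixes Z :: "('a::{field,finite} ^ 'n::finite) set"
  assumes "0 \<notin> Z"
  shows "(\<Sum>a\<in>UNIV. CARD('a) * card (Z \<inter> {x. dot a x = 0})) = card Z * CARD('a) ^ CARD('n)"
proof -
  have "(\<Sum>a\<in>UNIV. CARD('a) * card (Z \<inter> {x. dot a x = 0})) =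
      CARD('a) * (\<Sum>a\<in>UNIV. \<Sum>x\<in>Z. if dot a x = 0 then 1 else 0)"
    unfolding sum_distrib_left[symmetric]
    by (intro arg_cong2[of _ _ _ _ "(*)"] sum.cong refl) (simp add: sum.If_cases)
  also have "\<dots> = CARD('a) * (\<Sum>x\<in>Z. card {a. dot a x = 0})"
    by (subst sum.swap) (simp add: sum.If_cases)
  also have "\<dots> = (\<Sum>x\<in>Z. CARD('a) ^ CARD('n))"
    unfolding sum_distrib_left
    by (intro sum.cong refl card_dot_annihilator) (use assms in auto)
  finally show ?thesis by simp
qed

text \<open>Sum q times the size of the section of \<open>U\<close> over all \<open>a\<close>.
  Directly, an \<open>a\<close> in \<open>perp U\<close> contributes q |U| and any other
  \<open>a\<close> contributes |U|; by double counting, with 0 treated apart, the total is (|U| - 1)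
  q^n + q q^n. Comparing gives the product.\<close>

lemma card_perp:
  fixes U :: "('a::{field,finite} ^ 'n::finite) set"
  assumes U: "vec.subspace U"
  shows "card (perp U) * card U = CARD('a) ^ CARD('n)"
proof -
  let ?q = "int CARD('a)" and ?Q = "int (CARD('a) ^ CARD('n))"
  let ?u = "int (card U)" and ?m = "int (card (perp U))"
  have q: "?q > 1" using card_field_gt_1[where 'a = 'a] by simp
  have cU: "card (UNIV :: ('a ^ 'n) set) = CARD('a) ^ CARD('n)"
    by simp
  have 0: "0 \<in> U" using U by (rule vec.subspace_0)
  have split: "card (U \<inter> {x. dot a x = 0}) = card ((U - {0}) \<inter> {x. dot a x = 0}) + 1" for a
  proof -
    have "U \<inter> {x. dot a x = 0} = insert 0 ((U - {0}) \<inter> {x. dot a x = 0})" using 0 by auto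
    then show ?thesis by simp
  qed
  have "(\<Sum>a\<in>UNIV. ?q * int (card (U \<inter> {x. dot a x = 0}))) =
      (\<Sum>a\<in>perp U. ?q * ?u) + (\<Sum>a\<in>UNIV - perp U. ?u)"
  proof -
    have "(\<Sum>a\<in>UNIV. ?q * int (card (U \<inter> {x. dot a x = 0}))) =
        (\<Sum>a\<in>perp U. ?q * int (card (U \<inter> {x. dot a x = 0}))) +
        (\<Sum>a\<in>UNIV - perp U. ?q * int (card (U \<inter> {x. dot a x = 0})))"
      by (rule sum.subset_diff[THEN trans]) (auto simp: add.commute)
    moreover have "U \<inter> {x. dot a x = 0} = U" if "a \<in> perp U" for a
      using that by (auto simp: perp_def)
    moreover have "?q * int (card (U \<inter> {x. dot a x = 0})) = ?u" if "a \<in> UNIV - perp U" for a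
      using that card_hyperplane_section[OF U, of _ a] by (auto simp: perp_def simp flip: of_nat_mult)
    ultimately show ?thesis by simp
  qed
  also have "\<dots> = ?m * ?q * ?u + (?Q - ?m) * ?u"
  proof -
    have "card (perp U) + card (UNIV - perp U) = CARD('a) ^ CARD('n)"
      unfolding cU[symmetric] by (subst card_Un_disjoint[symmetric]) auto
    then have "int (card (UNIV - perp U)) = ?Q - ?m" by linarith
    then show ?thesis by simp
  qed
  finally have 1: "(\<Sum>a\<in>UNIV. ?q * int (card (U \<inter> {x. dot a x = 0}))) = ?m * ?q * ?u + (?Q - ?m) * ?u" .
  have "(\<Sum>a\<in>UNIV. ?q * int (card (U \<inter> {x. dot a x = 0}))) =
      int (\<Sum>a\<in>UNIV. CARD('a) * card ((U - {0}) \<inter> {x. dot a x = 0})) + ?q * ?Q"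
    unfolding split by (simp add: distrib_left sum.distrib mult.commute)
  also have "\<dots> = (?u - 1) * ?Q + ?q * ?Q"
  proof -
    have "card U > 0" using 0 by (auto simp: card_gt_0_iff)
    then have "int (card (U - {0})) = ?u - 1" using 0 by (simp add: of_nat_diff)
    then show ?thesis by (subst double_count_dot) auto
  qed
  finally have "(?q - 1) * (?m * ?u) = (?q - 1) * ?Q"
    using 1 by (simp add: algebra_simps)
  then have "?m * ?u = ?Q" using q by simp
  then show ?thesis by (metis of_nat_eq_iff of_nat_mult)
qed

text \<open>By \<open>double_count_dot\<close> the average of the left side over all
  \<open>a\<close> is exactly \<open>card Z\<close>. Each \<open>a\<close> in \<open>perp W\<close>,
  for instance 0, lies strictly above the average, so some other \<open>a\<close> lies strictly
  below.\<close>

lemma sparse_hyperplane_section: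
  fixes Z :: "('a::{field,finite} ^ 'n::finite) set"
  assumes Z: "Z \<subseteq> W" "0 \<notin> Z" "Z \<noteq> {}"
  obtains a where "a \<notin> perp W" "CARD('a) * card (Z \<inter> {x. dot a x = 0}) < card Z"
proof (rule ccontr)
  assume "\<not> thesis"
  with that have large: "card Z \<le> CARD('a) * card (Z \<inter> {x. dot a x = 0})" if "a \<notin> perp W" for a
    using \<open>a \<notin> perp W\<close> not_less by blast
  have all: "Z \<inter> {x. dot a x = 0} = Z" if "a \<in> perp W" for a
    using that Z by (auto simp: perp_def)
  have q: "CARD('a) > 1" by (rule card_field_gt_1)
  have z: "card Z > 0" using Z by (simp add: card_gt_0_iff)
  have "card Z * CARD('a) ^ CARD('n) = (\<Sum>a\<in>(UNIV :: ('a ^ 'n) set). card Z)"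
    by simp
  also have "\<dots> < (\<Sum>a\<in>UNIV. CARD('a) * card (Z \<inter> {x. dot a x = 0}))"
  proof (rule sum_strict_mono_ex1)
    show "\<forall>a\<in>UNIV. card Z \<le> CARD('a) * card (Z \<inter> {x. dot a x = 0})"
      using large all q by (metis Suc_leI mult_le_mono1 nat_mult_1 less_imp_le One_nat_def)
    show "\<exists>a\<in>UNIV. card Z < CARD('a) * card (Z \<inter> {x. dot a x = 0})"
      using all[OF zero_in_perp] q z by (intro bexI[of _ 0]) auto
  qed simp
  also have "\<dots> = card Z * CARD('a) ^ CARD('n)"
    by (rule double_count_dot) fact
  finally show False by simp
qed

text \<open>
  Call a nonzero vector a hole if no member of \<open>T\<close> contains it. If \<open>T\<close> had \<open>L + 2\<close> members, the
  number of holes in a subspace of codimension \<open>j\<close> would be \<open>((q - 1) C - 1) q\<^bsup>k-j\<^esup> + 1\<close> for some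
  integer \<open>C\<close>, with \<open>C = (q\<^sup>r - 1) / (q - 1)\<close> for \<open>j = 0\<close>. Passing to a sparse hyperplane section
  decreases \<open>C\<close>, and after \<open>k - 1\<close> steps the number of holes is negative.
\<close>

lemma partial_spread_card_le:
  fixes S :: "('a::{field,finite} ^ 'n::finite) set set"
  assumes S: "\<And>U. U \<in> S \<Longrightarrow> vec.subspace U" "\<And>U. U \<in> S \<Longrightarrow> vec.dim U = k"
    and disj: "\<And>U V. U \<in> S \<Longrightarrow> V \<in> S \<Longrightarrow> U \<noteq> V \<Longrightarrow> U \<inter> V = {0}"
    and k: "k > 0" and L: "L * (CARD('a) ^ k - 1) + CARD('a) ^ (k + r) = CARD('a) ^ CARD('n)"
    and dvd: "CARD('a) ^ k dvd L" and r: "(\<Sum>i<r. CARD('a) ^ i) < k"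
  shows "card S \<le> L + 1"
proof (rule ccontr)
  assume "\<not> card S \<le> L + 1"
  then obtain T where T: "T \<subseteq> S" "card T = L + 2" "finite T"
    using obtain_subset_with_card_n[of "L + 2" S] by auto
  let ?n = "CARD('n)"
  define q where "q = int CARD('a)"
  define \<theta> where "\<theta> = (\<Sum>i<r. q ^ i)"
  have q: "q > 1" using card_field_gt_1[where 'a = 'a] by (simp add: q_def)
  have theta: "(q - 1) * \<theta> = q ^ r - 1" "\<theta> < int k"
    unfolding \<theta>_def using r power_diff_1_eq[of q r]
    by (auto simp: q_def simp flip: of_nat_power of_nat_sum)
  have T0: "vec.subspace U" "card U = CARD('a) ^ k" "0 \<in> U" if "U \<in> T" for U
    using S that T by (auto simp: card_subspace vec.subspace_0)
  have kn: "k \<le> ?n"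
  proof -
    obtain U where "U \<in> T" using T(2) by fastforce
    then have "vec.dim U = k" using S T by auto
    then show ?thesis using vec.dim_subset_UNIV[of U] by (simp add: vec.dimension_def card_cart_basis)
  qed
  define hole where "hole W = {x \<in> W. x \<noteq> 0 \<and> (\<forall>U\<in>T. x \<notin> U)}" for W
  \<comment> \<open>\<open>W\<close> is partitioned into 0, its holes and the nonzero vectors of the
    members of \<open>T\<close>.\<close>
  have count: "int (card W) = 1 + int (card (hole W)) + (\<Sum>U\<in>T. int (card (U \<inter> W)) - 1)"
    if W: "vec.subspace W" for W
  proof -
    have 0: "0 \<in> W" using W by (rule vec.subspace_0)
    have "card W = card ({0} \<union> hole W \<union> (\<Union>U\<in>T. U \<inter> W - {0}))"
      by (rule arg_cong[of _ _ card]) (use 0 in \<open>auto simp: hole_def\<close>)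
    also have "\<dots> = card ({0} \<union> hole W) + card (\<Union>U\<in>T. U \<inter> W - {0})"
      by (rule card_Un_disjoint) (auto simp: hole_def)
    also have "card ({0} \<union> hole W) = 1 + card (hole W)"
      by (subst card_Un_disjoint) (auto simp: hole_def)
    also have "card (\<Union>U\<in>T. U \<inter> W - {0}) = (\<Sum>U\<in>T. card (U \<inter> W - {0}))"
      by (rule card_UN_disjoint) (use T disj in \<open>fastforce+\<close>)
    also have "\<dots> = (\<Sum>U\<in>T. card (U \<inter> W) - 1)"
      by (rule sum.cong) (use 0 T0 in \<open>auto simp: card_Diff_singleton\<close>)
    finally have "int (card W) = 1 + int (card (hole W)) + (\<Sum>U\<in>T. int (card (U \<inter> W) - 1))"
      by simp
    also have "(\<Sum>U\<in>T. int (card (U \<inter> W) - 1)) = (\<Sum>U\<in>T. int (card (U \<inter> W)) - 1)"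
    proof (rule sum.cong)
      fix U assume "U \<in> T"
      then have "card (U \<inter> W) > 0" using 0 T0 by (auto simp: card_gt_0_iff)
      then show "int (card (U \<inter> W) - 1) = int (card (U \<inter> W)) - 1" by simp
    qed simp
    finally show ?thesis .
  qed
  have dvd_card: "q - 1 dvd int (card W) - 1" if "vec.subspace W" for W :: "('a ^ 'n) set"
    using power_diff_1_eq[of q "vec.dim W"] card_subspace[OF that] by (simp add: q_def)
  \<comment> \<open>Two congruences combine. Modulo q^e the number of holes is 1, since with L + 2
    members it equals 1 + |W| + L minus the sum of the |U \<inter> W|. Modulo q - 1 it is 0, since
    the number of nonzero vectors in any subspace is.\<close>
  have shape: "\<exists>C. int (card (hole W)) = ((q - 1) * C - 1) * q ^ e + 1"
    if W: "vec.subspace W" and e: "e \<le> k" "q ^ e dvd int (card W)"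
      "\<And>U. U \<in> T \<Longrightarrow> q ^ e dvd int (card (U \<inter> W))" for W e
  proof -
    have eq: "int (card (hole W)) - 1 = int (card W) + int L - (\<Sum>U\<in>T. int (card (U \<inter> W)))"
      using count[OF W] T by (simp add: sum_subtractf)
    have "q ^ e dvd q ^ k" using e by (simp add: le_imp_power_dvd)
    moreover have "q ^ k dvd int L" using dvd unfolding q_def by (metis of_nat_dvd_iff of_nat_power)
    ultimately have "q ^ e dvd int L" by (rule dvd_trans)
    then have "q ^ e dvd int (card (hole W)) - 1"
      unfolding eq using e by (intro dvd_diff dvd_add dvd_sum) auto
    then obtain c where c: "int (card (hole W)) = q ^ e * c + 1"
      by (metis dvdE diff_add_cancel)
    have "int (card (hole W)) = (int (card W) - 1) - (\<Sum>U\<in>T. int (card (U \<inter> W)) - 1)"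
      using count[OF W] by simp
    moreover have "q - 1 dvd (\<Sum>U\<in>T. int (card (U \<inter> W)) - 1)"
      using W T0 by (intro dvd_sum dvd_card vec.subspace_inter) auto
    ultimately have "q - 1 dvd int (card (hole W))"
      using dvd_card[OF W] by (metis dvd_diff)
    moreover have "q - 1 dvd (q ^ e - 1) * c" using power_diff_1_eq[of q e] by simp
    ultimately have "q - 1 dvd (q ^ e * c + 1) - (q ^ e - 1) * c" unfolding c by (rule dvd_diff)
    then have "q - 1 dvd c + 1" by (simp add: algebra_simps)
    then obtain C where "c + 1 = (q - 1) * C" by (rule dvdE)
    then have "c = (q - 1) * C - 1" by simp
    then show ?thesis using c by (auto simp: mult.commute)
  qed
  \<comment> \<open>The third condition says that the constant C of \<open>shape\<close> is at most
    \<open>\<theta> - j\<close>. The second persists because a hyperplane section divides the size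
    of \<open>U \<inter> W\<close> by q or leaves it unchanged.\<close>
  have "\<exists>W. vec.subspace W \<and> int (card W) = q ^ (?n - j) \<and>
      (\<forall>U\<in>T. q ^ (k - j) dvd int (card (U \<inter> W))) \<and>
      int (card (hole W)) \<le> ((q - 1) * (\<theta> - int j) - 1) * q ^ (k - j) + 1" if "j < k" for j
    using that
  proof (induction j)
    case 0
    have "int (card (hole UNIV)) = q ^ ?n - 1 - (int L + 2) * (q ^ k - 1)"
      using count[of UNIV] T T0 by (simp add: q_def vec.subspace_UNIV)
    also have "\<dots> = q ^ (k + r) - 1 - 2 * (q ^ k - 1)"
    proof -
      have "int (L * (CARD('a) ^ k - 1) + CARD('a) ^ (k + r)) = q ^ ?n"
        unfolding L by (simp add: q_def)
      then have "int L * (q ^ k - 1) + q ^ (k + r) = q ^ ?n"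
        using card_field_gt_1[where 'a = 'a] by (simp add: q_def of_nat_diff)
      then show ?thesis by (simp add: algebra_simps)
    qed
    also have "\<dots> = ((q - 1) * \<theta> - 1) * q ^ k + 1"
      unfolding theta(1) by (simp add: algebra_simps power_add)
    finally show ?case
      using T0 by (intro exI[of _ UNIV]) (auto simp: vec.subspace_UNIV q_def)
  next
    case (Suc j)
    then obtain W where W: "vec.subspace W" "int (card W) = q ^ (?n - j)"
      "\<And>U. U \<in> T \<Longrightarrow> q ^ (k - j) dvd int (card (U \<inter> W))"
      "int (card (hole W)) \<le> ((q - 1) * (\<theta> - int j) - 1) * q ^ (k - j) + 1"
      by auto
    define e where "e = k - Suc j"
    have e: "k - j = Suc e" "e \<le> k" "?n - j = Suc (?n - Suc j)" "e \<le> ?n - Suc j"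
      using Suc.prems kn by (auto simp: e_def)
    have "q ^ (k - j) dvd int (card W)"
      unfolding W(2) using kn by (intro le_imp_power_dvd) auto
    then obtain C where C: "int (card (hole W)) = ((q - 1) * C - 1) * q ^ (k - j) + 1"
      using shape[OF W(1) _ _ W(3)] by auto
    \<comment> \<open>The number of holes is 1 modulo q.\<close>
    have "hole W \<noteq> {}"
    proof
      assume "hole W = {}"
      then have "q * (((q - 1) * C - 1) * q ^ e) = -1" using C e by (simp add: mult_ac)
      then have "q dvd 1" by (metis dvd_triv_left dvd_minus_iff)
      then show False using q by simp
    qed
    then obtain a where a: "a \<notin> perp W" "CARD('a) * card (hole W \<inter> {x. dot a x = 0}) < card (hole W)"
      by (rule sparse_hyperplane_section[of "hole W" W, rotated 2]) (auto simp: hole_def)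
    define W' where "W' = W \<inter> {x. dot a x = 0}"
    have W': "vec.subspace W'"
      unfolding W'_def by (intro vec.subspace_inter W(1) subspace_dot_kernel)
    obtain v where v: "v \<in> W" "dot a v \<noteq> 0" using a(1) by (auto simp: perp_def)
    have "q * int (card W') = int (card W)"
      using card_hyperplane_section[OF W(1) v] unfolding W'_def q_def by (metis of_nat_mult)
    then have cW': "int (card W') = q ^ (?n - Suc j)"
      using W(2) e(3) q by simp
    have sect: "q ^ e dvd int (card (U \<inter> W'))" if U: "U \<in> T" for U
    proof (cases "\<exists>v\<in>U \<inter> W. dot a v \<noteq> 0")
      case True
      then obtain v where "v \<in> U \<inter> W" "dot a v \<noteq> 0" by auto
      then have "q * int (card (U \<inter> W')) = int (card (U \<inter> W))"
        using card_hyperplane_section[OF vec.subspace_inter[OF T0(1)[OF U] W(1)]]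
        unfolding W'_def q_def by (metis Int_assoc of_nat_mult)
      then have "q * q ^ e dvd q * int (card (U \<inter> W'))"
        using W(3)[OF U] e(1) by simp
      then show ?thesis using q by simp
    next
      case False
      then have "U \<inter> W' = U \<inter> W" by (auto simp: W'_def)
      then show ?thesis using W(3)[OF U] e(1) by (simp add: dvd_mult_right)
    qed
    have "q ^ e dvd int (card W')"
      unfolding cW' using e by (intro le_imp_power_dvd) auto
    then obtain C' where C': "int (card (hole W')) = ((q - 1) * C' - 1) * q ^ e + 1"
      using shape[OF W' e(2) _ sect] by auto
    have "hole W \<inter> {x. dot a x = 0} = hole W'" by (auto simp: hole_def W'_def)
    then have "q * int (card (hole W')) < int (card (hole W))"
      using a(2) unfolding q_def by (metis of_nat_less_iff of_nat_mult)
    \<comment> \<open>The terms -1 cancel between the two sides and leave the negative slack 1 - q,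
      which makes \<open>C'\<close> strictly smaller than \<open>\<theta> - j\<close>.\<close>
    then have "q * (((q - 1) * C' - 1) * q ^ e + 1) < ((q - 1) * (\<theta> - int j) - 1) * q ^ Suc e + 1"
      unfolding C' using W(4) e(1) by simp
    then have "(q - 1) * q ^ Suc e * (C' - (\<theta> - int j)) < 1 - q"
      by (simp add: algebra_simps)
    then have "(q - 1) * q ^ Suc e * (C' - (\<theta> - int j)) < 0" using q by simp
    moreover have "(q - 1) * q ^ Suc e > 0" using q by simp
    ultimately have "C' - (\<theta> - int j) < 0" by (meson mult_nonneg_nonneg not_less order_less_imp_le)
    then have "C' \<le> \<theta> - int (Suc j)" by simp
    then have "((q - 1) * C' - 1) * q ^ e \<le> ((q - 1) * (\<theta> - int (Suc j)) - 1) * q ^ e"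
      using q by (intro mult_right_mono diff_right_mono mult_left_mono) auto
    then show ?case
      using W' cW' sect C' by (intro exI[of _ W']) (auto simp: e_def)
  qed
  \<comment> \<open>The exponent is now 1 and \<open>\<theta> - (k - 1)\<close> is at most 0, so the
    number of holes is at most 1 - q.\<close>
  from this[of "k - 1"] k obtain W where
    W: "int (card (hole W)) \<le> ((q - 1) * (\<theta> - int (k - 1)) - 1) * q ^ (k - (k - 1)) + 1"
    by auto
  have "\<theta> - int (k - 1) \<le> 0" using theta(2) k by simp
  then have "(q - 1) * (\<theta> - int (k - 1)) \<le> 0" using q by (simp add: mult_nonneg_nonpos)
  then have "((q - 1) * (\<theta> - int (k - 1)) - 1) * q \<le> (-1) * q"
    using q by (intro mult_right_mono) auto
  then show False using W k q by simp
qed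

section \<open>Partial spreads nested in dual partial spreads\<close>

definition ssum :: "('a::field ^ 'n) set \<Rightarrow> ('a ^ 'n) set \<Rightarrow> ('a ^ 'n) set" where
  "ssum U V = {x + y |x y. x \<in> U \<and> y \<in> V}"

lemma ssumI: "x \<in> U \<Longrightarrow> y \<in> V \<Longrightarrow> x + y \<in> ssum U V"
  by (auto simp: ssum_def)

lemma ssum_commute: "ssum U V = ssum V U"
proof -
  have "ssum U V \<subseteq> ssum V U" for U V :: "('a::field ^ 'n) set"
    unfolding ssum_def by (auto intro: add.commute)
  then show ?thesis by blast
qed

lemma subspace_ssum: "vec.subspace U \<Longrightarrow> vec.subspace V \<Longrightarrow> vec.subspace (ssum U V)"
  unfolding ssum_def by (rule vec.subspace_sums)

lemma dim_ssum_Int: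
  assumes "vec.subspace U" "vec.subspace (V :: ('a::field ^ 'n::finite) set)"
  shows "vec.dim (ssum U V) + vec.dim (U \<inter> V) = vec.dim U + vec.dim V"
  unfolding ssum_def using assms by (rule vec.dim_sums_Int)

lemma ssum_subset: "vec.subspace H \<Longrightarrow> U \<subseteq> H \<Longrightarrow> V \<subseteq> H \<Longrightarrow> ssum U V \<subseteq> H"
  by (auto simp: ssum_def intro: vec.subspace_add)

lemma ssum_supset1: "0 \<in> V \<Longrightarrow> U \<subseteq> ssum U V"
  using ssumI[of _ U 0 V] by auto

lemma ssum_supset2: "0 \<in> U \<Longrightarrow> V \<subseteq> ssum U V"
  using ssumI[of 0 U _ V] by auto

text \<open>Extend a basis of \<open>U\<close> to one of \<open>V\<close>, order the added vectors
  and adjoin them one at a time. Monotonicity holds for all indices because \<open>take\<close> and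
  the truncated subtraction saturate.\<close>

lemma subspace_chain_exists:
  fixes U V :: "('a::field ^ 'n::finite) set"
  assumes U: "vec.subspace U" and V: "vec.subspace V" and UV: "U \<subseteq> V"
  obtains G where "\<And>t. vec.dim U \<le> t \<Longrightarrow> t \<le> vec.dim V \<Longrightarrow>
      vec.subspace (G t) \<and> vec.dim (G t) = t \<and> U \<subseteq> G t \<and> G t \<subseteq> V"
    "\<And>s t. s \<le> t \<Longrightarrow> G s \<subseteq> G t"
proof -
  obtain B where B: "B \<subseteq> U" "vec.independent B" "U \<subseteq> vec.span B" "card B = vec.dim U"
    using vec.basis_exists by blast
  have sB: "vec.span B = U" using B U vec.span_subspace by blast
  obtain C where C: "B \<subseteq> C" "C \<subseteq> V" "vec.independent C" "V \<subseteq> vec.span C"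
    using vec.maximal_independent_subset_extend[of B V] B UV by blast
  have fC: "finite C" using C(3) by (rule vec.finiteI_independent)
  then obtain xs where xs: "set xs = C - B" "distinct xs"
    using finite_distinct_list by blast
  have dC: "card C = vec.dim V" using C vec.basis_card_eq_dim by blast
  then have len: "length xs = vec.dim V - vec.dim U"
    using xs B(4) C(1) fC by (metis card_Diff_subset distinct_card finite_subset)
  define G where "G t = vec.span (B \<union> set (take (t - vec.dim U) xs))" for t
  show thesis
  proof (rule that[of G])
    fix t assume t: "vec.dim U \<le> t" "t \<le> vec.dim V"
    let ?D = "B \<union> set (take (t - vec.dim U) xs)"
    have D: "?D \<subseteq> C" using C(1) xs(1) set_take_subset by fast
    have "card ?D = card B + card (set (take (t - vec.dim U) xs))"
      by (rule card_Un_disjoint) (use xs set_take_subset[of "t - vec.dim U" xs] C(1) fC finite_subset in \<open>auto\<close>)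
    also have "\<dots> = t"
      using t xs(2) len B(4) by (simp add: distinct_card)
    finally have "vec.dim (G t) = t"
      using vec.dim_span_eq_card_independent[of ?D] vec.independent_mono[OF C(3) D] by (simp add: G_def)
    moreover have "U \<subseteq> G t" unfolding G_def sB[symmetric] by (rule vec.span_mono) simp
    moreover have "G t \<subseteq> V" unfolding G_def using D C(2) V by (intro vec.span_minimal) auto
    ultimately show "vec.subspace (G t) \<and> vec.dim (G t) = t \<and> U \<subseteq> G t \<and> G t \<subseteq> V"
      by (simp add: G_def)
  next
    fix s t :: nat assume "s \<le> t"
    then show "G s \<subseteq> G t"
      unfolding G_def by (intro vec.span_mono Un_mono order_refl set_take_subset_set_take diff_le_mono)
  qed
qed

lemma subspace_of_dim_exists:
  fixes V :: "('a::field ^ 'n::finite) set"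
  assumes "vec.subspace V" "t \<le> vec.dim V"
  obtains U where "vec.subspace U" "U \<subseteq> V" "vec.dim U = t"
proof -
  have "vec.subspace {0 :: 'a ^ 'n}" "{0} \<subseteq> V" "vec.dim {0 :: 'a ^ 'n} = 0"
    using assms vec.subspace_0 by (auto simp: vec.subspace_single_0)
  then show thesis
    using subspace_chain_exists[of "{0}" V] assms that by (metis le0)
qed

lemma subspace_complement_exists:
  fixes U V :: "('a::field ^ 'n::finite) set"
  assumes U: "vec.subspace U" and V: "vec.subspace V" and UV: "U \<subseteq> V"
  obtains W where "vec.subspace W" "W \<subseteq> V" "ssum U W = V" "U \<inter> W = {0}"
    "vec.dim U + vec.dim W = vec.dim V"
proof -
  obtain B where B: "B \<subseteq> U" "vec.independent B" "U \<subseteq> vec.span B" "card B = vec.dim U"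
    using vec.basis_exists by blast
  have sB: "vec.span B = U" using B U vec.span_subspace by blast
  obtain C where C: "B \<subseteq> C" "C \<subseteq> V" "vec.independent C" "V \<subseteq> vec.span C"
    using vec.maximal_independent_subset_extend[of B V] B UV by blast
  have sC: "vec.span C = V" using C V vec.span_subspace by blast
  have fC: "finite C" using C(3) by (rule vec.finiteI_independent)
  define W where "W = vec.span (C - B)"
  have W: "vec.subspace W" by (simp add: W_def)
  have "vec.span (B \<union> (C - B)) = ssum U W"
    unfolding vec.span_Un sB W_def ssum_def by blast
  moreover have "B \<union> (C - B) = C" using C(1) by auto
  ultimately have sum: "ssum U W = V" using sC by simp
  have dW: "vec.dim W = card (C - B)"
    unfolding W_def by (intro vec.dim_span_eq_card_independent vec.independent_mono[OF C(3)]) auto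
  have dV: "card C = vec.dim V" using C vec.basis_card_eq_dim by blast
  have dim: "vec.dim U + vec.dim W = vec.dim V"
    using dW dV B(4) C(1) fC by (metis card_Diff_subset card_mono finite_subset le_add_diff_inverse)
  then have "vec.dim (U \<inter> W) = 0" using dim_ssum_Int[OF U W] sum by simp
  then have "U \<inter> W = {0}" using vec.subspace_0[OF U] vec.subspace_0[OF W] by auto
  moreover have "W \<subseteq> V" unfolding W_def using C V by (intro vec.span_minimal) auto
  ultimately show thesis using that W sum dim by blast
qed

text \<open>For subspaces and \<open>H = UNIV\<close> the second condition is the first one for the
  orthogonal spaces. The ambient \<open>H\<close> is a parameter because it grows in the
  induction.\<close>

definition pair_compatible ::
  "('a::field ^ 'n) set \<Rightarrow> ('a ^ 'n) set \<times> ('a ^ 'n) set \<Rightarrow> ('a ^ 'n) set \<times> ('a ^ 'n) set \<Rightarrow> bool" where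
  "pair_compatible H p p' \<longleftrightarrow> fst p \<inter> fst p' = {0} \<and> H \<subseteq> ssum (snd p) (snd p')"

lemma pair_compatible_sym: "pair_compatible H p p' \<Longrightarrow> pair_compatible H p' p"
  by (auto simp: pair_compatible_def ssum_commute)

lemma pairwise_Un_symmetric:
  assumes "pairwise R A" "pairwise R B"
    and "\<And>a b. a \<in> A \<Longrightarrow> b \<in> B \<Longrightarrow> R a b" "\<And>a b. R a b \<Longrightarrow> R b a"
  shows "pairwise R (A \<union> B)"
  using assms unfolding pairwise_def by blast

text \<open>
  The inclusion \<open>U \<subseteq> V\<close> is not part of the definition: the induction starts from a single pair in
  a space of dimension \<open>k + r\<close>, where it may be impossible, and the first inductive step restores it.
\<close>

definition pair_family :: "nat \<Rightarrow> ('a::field ^ 'n) set \<Rightarrow> (('a ^ 'n) set \<times> ('a ^ 'n) set) set \<Rightarrow> bool" where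
  "pair_family k H P \<longleftrightarrow>
     (\<forall>(U, V)\<in>P. vec.subspace U \<and> vec.dim U = k \<and> U \<subseteq> H \<and>
                vec.subspace V \<and> vec.dim V + k = vec.dim H \<and> V \<subseteq> H) \<and>
     pairwise (pair_compatible H) P"

lemma pair_family_dim_fst: "pair_family k H P \<Longrightarrow> p \<in> P \<Longrightarrow> vec.dim (fst p) = k"
  unfolding pair_family_def by auto

text \<open>Thanks to this, compatibility alone gives the injectivity and disjointness needed to
  count the extended family.\<close>

lemma pair_compatible_neq:
  assumes "pair_compatible H p p'" "vec.dim (fst p) > 0"
  shows "p \<noteq> (p' :: ('a::field ^ 'n::finite) set \<times> _)"
  using assms by (auto simp: pair_compatible_def)

text \<open>
  Write \<open>H = E \<oplus> H'\<close>, let \<open>M\<close> be a spread set on \<open>H'\<close> and let \<open>pr: H' \<rightarrow> E\<close> be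
  onto, with \<open>Y \<subseteq> H'\<close> mapped bijectively to \<open>E\<close>. The new pairs are the images of \<open>(Y, H')\<close> under
  \<open>pr + f\<close> for \<open>f \<in> M\<close>. An old pair \<open>(U, V)\<close> is kept as \<open>(U, E \<oplus> V)\<close>, except that one of them,
  \<open>(U\<^sub>0, V\<^sub>0)\<close>, is replaced by the two pairs \<open>(E, E \<oplus> V\<^sub>0)\<close> and \<open>(U\<^sub>0, H')\<close>.
\<close>

lemma pair_family_extend:
  fixes H :: "('a::{field,finite} ^ 'n::finite) set"
  assumes k: "k > 0" and H: "vec.subspace H" and H': "vec.subspace H'" "H' \<subseteq> H"
    and dim: "vec.dim H = k + vec.dim H'" "k \<le> vec.dim H'"
    and P: "pair_family k H' P" "finite P" "P \<noteq> {}"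
    and sub: "card P > 1 \<Longrightarrow> \<forall>(U, V)\<in>P. U \<subseteq> V"
  obtains P' where "pair_family k H P'" "finite P'"
    "card P' = CARD('a) ^ vec.dim H' + card P" "\<forall>(U, V)\<in>P'. U \<subseteq> V"
proof -
  obtain E where E: "vec.subspace E" "E \<subseteq> H" "ssum H' E = H" "H' \<inter> E = {0}" "vec.dim E = k"
    using subspace_complement_exists[OF H'(1) H H'(2)] dim(1) by (metis add.commute add_left_cancel)
  obtain Y where Y: "vec.subspace Y" "Y \<subseteq> H'" "vec.dim Y = k"
    using subspace_of_dim_exists[OF H'(1) dim(2)] .
  \<comment> \<open>\<open>\<phi>\<close> copies \<open>E\<close> into \<open>H'\<close> with image
    \<open>Y\<close>, and \<open>pr\<close> will undo it; this uses k \<le> dim H'.\<close>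
  obtain \<phi> where phi: "Vector_Spaces.linear (*s) (*s) \<phi>" "\<phi> ` E = Y" "inj_on \<phi> E"
    using vec.subspace_isomorphism[OF E(1) Y(1)] E Y by auto
  obtain pr where pr: "range pr \<subseteq> E" "Vector_Spaces.linear (*s) (*s) pr" "\<And>x. x \<in> E \<Longrightarrow> pr (\<phi> x) = x"
    using vec.linear_exists_left_inverse_on[OF phi(1) E(1) phi(3)] by auto
  have pos: "vec.dim H' > 0" using k dim(2) by simp
  obtain M where M0: "finite M" "card M = CARD('a) ^ vec.dim H' - 1"
    "\<forall>f\<in>M. Vector_Spaces.linear (*s) (*s) f \<and> f ` H' = H' \<and> inj_on f H'"
    "\<forall>f\<in>M. \<forall>g\<in>M. f \<noteq> g \<longrightarrow> inj_on (\<lambda>x. f x - g x) H'"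
    using spread_set_exists[OF H'(1) refl pos] .
  have M: "Vector_Spaces.linear (*s) (*s) f" "f ` H' = H'" "inj_on f H'" if "f \<in> M" for f
    using M0(3) that by blast+
  obtain U0 V0 where p0: "(U0, V0) \<in> P" using P(3) by auto
  have 0: "0 \<in> E" "0 \<in> H'" using E H' by (auto simp: vec.subspace_0)
  have prX: "pr x \<in> E" for x using pr(1) by auto
  have fH: "f x \<in> H'" if "f \<in> M" "x \<in> H'" for f x using M(2) that by blast
  \<comment> \<open>All disjointness claims below come from comparing components in
    \<open>H = E \<oplus> H'\<close>; \<open>A f x\<close> has components \<open>pr x\<close> and
    \<open>f x\<close>.\<close>
  have uniq: "a = b \<and> c = d" if "a \<in> E" "b \<in> E" "c \<in> H'" "d \<in> H'" "a + c = b + d" for a b c d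
  proof -
    have "a - b = d - c" using that(5) by (simp add: algebra_simps)
    moreover have "a - b \<in> E" "d - c \<in> H'" using that E H' by (auto intro: vec.subspace_diff)
    ultimately have "d - c \<in> H' \<inter> E" by simp
    then have "d - c = 0" using E(4) by auto
    then have "a - b = 0" "d - c = 0" using \<open>a - b = d - c\<close> by simp_all
    then show ?thesis by simp
  qed
  define A where "A f = (\<lambda>x. pr x + f x)" for f
  have Alin: "Vector_Spaces.linear (*s) (*s) (A f)" if "f \<in> M" for f
    unfolding A_def using pr(2) M(1)[OF that] by (rule vec.linear_compose_add)
  have Ainj: "inj_on (A f) H'" if "f \<in> M" for f
  proof (rule inj_onI)
    fix x y assume xy: "x \<in> H'" "y \<in> H'" "A f x = A f y"
    then have "f x = f y"
      using uniq[of "pr x" "pr y" "f x" "f y"] prX fH that by (auto simp: A_def)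
    then show "x = y" using M(3)[OF that] xy by (auto dest: inj_onD)
  qed
  have AY: "A f ` Y \<inter> H' = {0}" if f: "f \<in> M" for f
  proof -
    have "A f y = 0" if "y \<in> Y" "A f y \<in> H'" for y
    proof -
      have "pr y = 0 \<and> f y = A f y"
        by (rule uniq) (use prX fH[OF f] that Y(2) 0 in \<open>auto simp: A_def\<close>)
      moreover obtain x where "x \<in> E" "y = \<phi> x" using phi(2) \<open>y \<in> Y\<close> by auto
      ultimately have "y = \<phi> 0" using pr(3) by metis
      then show ?thesis using phi(1) Alin[OF f] by (simp add: vec.linear_0)
    qed
    moreover have "A f 0 = 0" using Alin[OF f] by (rule vec.linear_0)
    ultimately show ?thesis using 0 vec.subspace_0[OF Y(1)] by (auto intro!: image_eqI[of 0 "A f" 0])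
  qed
  have decomp: "\<exists>x\<in>E. \<exists>l\<in>H'. h = x + l" if "h \<in> H" for h
  proof -
    obtain l x where "l \<in> H'" "x \<in> E" "h = l + x" using \<open>h \<in> H\<close> E(3) by (auto simp: ssum_def)
    then show ?thesis by (metis add.commute)
  qed
  have AX: "H \<subseteq> ssum (A f ` H') W" if f: "f \<in> M" and W: "E \<subseteq> W" for f W
  proof
    fix h assume "h \<in> H"
    then obtain x l where h: "x \<in> E" "l \<in> H'" "h = x + l" using decomp by blast
    \<comment> \<open>Match the \<open>H'\<close>-component first; the error then lies in
      \<open>E\<close>.\<close>
    obtain l' where l': "l' \<in> H'" "f l' = l" using M(2)[OF f] h(2) by (metis imageE)
    have "A f l' + (x - pr l') \<in> ssum (A f ` H') W"
      using l' h E(1) W prX by (intro ssumI) (auto intro: vec.subspace_diff)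
    then show "h \<in> ssum (A f ` H') W" using l' h by (simp add: A_def add.commute)
  qed
  have AH: "H \<subseteq> ssum (A f ` H') H'" if f: "f \<in> M" for f
  proof
    fix h assume "h \<in> H"
    then obtain x l where h: "x \<in> E" "l \<in> H'" "h = x + l" using decomp by blast
    \<comment> \<open>Here the \<open>E\<close>-component is matched first, and the error lies in
      \<open>H'\<close>.\<close>
    have "\<phi> x \<in> H'" using h phi(2) Y(2) by auto
    then have "A f (\<phi> x) + (l - f (\<phi> x)) \<in> ssum (A f ` H') H'"
      using h H'(1) fH[OF f] by (intro ssumI) (auto intro: vec.subspace_diff)
    then show "h \<in> ssum (A f ` H') H'" using h pr(3) by (simp add: A_def)
  qed
  have AA: "pair_compatible H (A f ` Y, A f ` H') (A g ` Y, A g ` H')"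
    if fg: "f \<in> M" "g \<in> M" "f \<noteq> g" for f g
  proof -
    have diff: "inj_on (\<lambda>x. f x - g x) H'" using M0(4)[rule_format, of f g] fg by auto
    have "z = 0" if "z \<in> A f ` Y" "z \<in> A g ` Y" for z
    proof -
      obtain x y where xy: "x \<in> E" "y \<in> E" "z = A f (\<phi> x)" "z = A g (\<phi> y)"
        using \<open>z \<in> A f ` Y\<close> \<open>z \<in> A g ` Y\<close> phi(2) by blast
      have H: "\<phi> x \<in> H'" "\<phi> y \<in> H'" using xy phi(2) Y(2) by auto
      have "x = y \<and> f (\<phi> x) = g (\<phi> y)"
        by (rule uniq) (use xy H fH fg pr(3) in \<open>auto simp: A_def\<close>)
      then have "f (\<phi> x) - g (\<phi> x) = f 0 - g 0"
        using vec.linear_0[OF M(1)[OF fg(1)]] vec.linear_0[OF M(1)[OF fg(2)]] by auto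
      then have "\<phi> x = 0" using diff H(1) 0(2) by (auto dest: inj_onD)
      then show "z = 0" using xy(3) Alin[OF fg(1)] by (simp add: vec.linear_0)
    qed
    moreover have "0 \<in> A f ` Y" if "f \<in> M" for f
      using AY[OF that] by auto
    ultimately have 1: "A f ` Y \<inter> A g ` Y = {0}" using fg by auto
    have "h \<in> ssum (A f ` H') (A g ` H')" if "h \<in> H" for h
    proof -
      obtain u where u: "u \<in> E" "h - u \<in> H'"
        using decomp[OF \<open>h \<in> H\<close>] by auto
      obtain l where l: "l \<in> H'" "f l = h - u" using M(2)[OF fg(1)] u(2) by (metis imageE)
      have "(\<lambda>x. g x - f x) ` H' = H'"
      proof (rule endo_inj_surj)
        show "inj_on (\<lambda>x. g x - f x) H'" using M0(4)[rule_format, of g f] fg by auto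
        show "(\<lambda>x. g x - f x) ` H' \<subseteq> H'" using fH fg H'(1) by (auto intro: vec.subspace_diff)
      qed simp
      note surj = this
      \<comment> \<open>\<open>A f l\<close> has the right \<open>H'\<close>-component. Adding
        \<open>A f w\<close> repairs the \<open>E\<close>-component but adds \<open>f w\<close> in
        \<open>H'\<close>. Moving a suitable \<open>a\<close> from the argument of
        \<open>A f\<close> to that of \<open>A g\<close> keeps the \<open>E\<close>-component and
        cancels \<open>f w\<close>, as \<open>g - f\<close> is onto \<open>H'\<close>.\<close>
      define w where "w = \<phi> (u - pr l)"
      have w: "w \<in> H'" "pr w = u - pr l"
        using u prX E(1) phi(2) Y(2) pr(3) by (auto simp: w_def intro: vec.subspace_diff)
      have "- f w \<in> H'" using fH fg w H'(1) by (auto intro: vec.subspace_neg)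
      then have "- f w \<in> (\<lambda>x. g x - f x) ` H'" using surj by simp
      then obtain a where a: "a \<in> H'" "- f w = g a - f a" by auto
      have lin: "f (w - a) = f w - f a" "g a = - g (- a)" "pr (w - a) = pr w - pr a" "pr (- a) = - pr a"
        "f (l + (w - a)) = f l + f (w - a)" "pr (l + (w - a)) = pr l + pr (w - a)"
        "pr (a) = - pr (- a)"
        using M(1) fg pr(2) by (simp_all add: vec.linear_diff vec.linear_neg vec.linear_add)
      have "A f (l + (w - a)) + A g a = h"
        unfolding A_def lin(3,5,6) lin(1) using a(2) w(2) l(2) by (simp add: algebra_simps)
      moreover have "l + (w - a) \<in> H'" using l w a H'(1) by (auto intro: vec.subspace_diff vec.subspace_add)
      ultimately show ?thesis using a(1) by (metis imageI ssumI)
    qed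
    then show ?thesis using 1 by (auto simp: pair_compatible_def)
  qed
  have Pprop: "vec.subspace U" "vec.dim U = k" "U \<subseteq> H'" "vec.subspace V"
    "vec.dim V + k = vec.dim H'" "V \<subseteq> H'" if "(U, V) \<in> P" for U V
    using P(1) that unfolding pair_family_def by auto
  have Pcomp: "U \<inter> U' = {0}" "H' \<subseteq> ssum V V'"
    if "(U, V) \<in> P" "(U', V') \<in> P" "(U, V) \<noteq> (U', V')" for U V U' V'
  proof -
    have "pairwise (pair_compatible H') P" using P(1) by (simp add: pair_family_def)
    then have "pair_compatible H' (U, V) (U', V')" using that by (rule pairwiseD)
    then show "U \<inter> U' = {0}" "H' \<subseteq> ssum V V'" by (simp_all add: pair_compatible_def)
  qed
  have lift: "H \<subseteq> ssum (ssum E V) (ssum E V')" if V: "H' \<subseteq> ssum V V'" for V V'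
  proof
    fix h assume "h \<in> H"
    then obtain x l where h: "x \<in> E" "l \<in> H'" "h = x + l" using decomp by blast
    then obtain v v' where "v \<in> V" "v' \<in> V'" "l = v + v'" using V by (auto simp: ssum_def)
    then have "(x + v) + (0 + v') \<in> ssum (ssum E V) (ssum E V')" using h 0 by (intro ssumI) auto
    then show "h \<in> ssum (ssum E V) (ssum E V')" using h \<open>l = v + v'\<close> by (simp add: add.assoc)
  qed
  have XH: "H \<subseteq> ssum W H'" if "E \<subseteq> W" for W
    using decomp that by (fastforce simp: ssum_def)
  have Xsup: "E \<subseteq> ssum E V" if "(U, V) \<in> P" for U V
    using Pprop(4)[OF that] by (intro ssum_supset1 vec.subspace_0)
  define P1 where "P1 = (\<lambda>f. (A f ` Y, A f ` H')) ` M"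
  \<comment> \<open>The map 0 is not in \<open>M\<close>: it would send both \<open>Y\<close> and
    \<open>H'\<close> onto \<open>E\<close>, which is in general too small for a second component.
    So \<open>E\<close> is paired with \<open>ssum E V0\<close>, and the freed \<open>U0\<close>
    with \<open>H'\<close>, a complement of \<open>E\<close> containing it. The count is (q^(dim H')
    - 1) + 2 + (card P - 1).\<close>
  define P2 where "P2 = {(E, ssum E V0), (U0, H')}"
  define P3 where "P3 = (\<lambda>(U, V). (U, ssum E V)) ` (P - {(U0, V0)})"
  have XU: "E \<inter> U = {0}" if "(U, V) \<in> P" for U V
    using E(4) Pprop(1,3)[OF that] 0 vec.subspace_0 by blast
  have AU: "A f ` Y \<inter> U = {0}" if "(U, V) \<in> P" "f \<in> M" for f U V
    using AY[OF that(2)] Pprop(1,3)[OF that(1)] vec.subspace_0 by blast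
  have AXd: "A f ` Y \<inter> E = {0}" if f: "f \<in> M" for f
  proof -
    have "A f y = 0" if "y \<in> Y" "A f y \<in> E" for y
    proof -
      have "y \<in> H'" using that Y by auto
      then have "pr y = A f y \<and> f y = 0"
        by (intro uniq) (use prX fH[OF f] that(2) 0 in \<open>auto simp: A_def\<close>)
      then have "f y = f 0" using vec.linear_0[OF M(1)[OF f]] by simp
      then have "y = 0" using M(3)[OF f] \<open>y \<in> H'\<close> 0 by (auto dest: inj_onD)
      then show ?thesis using Alin[OF f] by (simp add: vec.linear_0)
    qed
    moreover have "0 \<in> A f ` Y" using AY[OF f] by auto
    ultimately show ?thesis using 0 by auto
  qed
  have c12: "pair_compatible H p p'" if "p \<in> P1" "p' \<in> P2" for p p'
  proof -
    obtain f where f: "f \<in> M" "p = (A f ` Y, A f ` H')" using \<open>p \<in> P1\<close> unfolding P1_def by blast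
    have "pair_compatible H p (E, ssum E V0)" "pair_compatible H p (U0, H')"
      unfolding f(2) pair_compatible_def fst_conv snd_conv
      using AU[OF p0 f(1)] AXd[OF f(1)] AH[OF f(1)] AX[OF f(1) Xsup[OF p0]] by blast+
    then show ?thesis using \<open>p' \<in> P2\<close> unfolding P2_def by blast
  qed
  have c13: "pair_compatible H p p'" if "p \<in> P1" "p' \<in> P3" for p p'
  proof -
    obtain f where f: "f \<in> M" "p = (A f ` Y, A f ` H')" using \<open>p \<in> P1\<close> unfolding P1_def by blast
    obtain U V where UV: "(U, V) \<in> P" "p' = (U, ssum E V)" using \<open>p' \<in> P3\<close> by (auto simp: P3_def)
    show ?thesis
      unfolding f(2) UV(2) pair_compatible_def fst_conv snd_conv
      using AU[OF UV(1) f(1)] AX[OF f(1) Xsup[OF UV(1)]] by blast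
  qed
  have c23: "pair_compatible H p p'" if "p \<in> P2" "p' \<in> P3" for p p'
  proof -
    obtain U V where UV: "(U, V) \<in> P" "(U0, V0) \<noteq> (U, V)" "p' = (U, ssum E V)"
      using \<open>p' \<in> P3\<close> by (auto simp: P3_def)
    have "pair_compatible H (E, ssum E V0) p'" "pair_compatible H (U0, H') p'"
      unfolding UV(3) pair_compatible_def fst_conv snd_conv ssum_commute[of H']
      using XU[OF UV(1)] lift[OF Pcomp(2)[OF p0 UV(1,2)]] Pcomp(1)[OF p0 UV(1,2)]
        XH[OF Xsup[OF UV(1)]] by blast+
    then show ?thesis using \<open>p \<in> P2\<close> unfolding P2_def by blast
  qed
  have c1: "pairwise (pair_compatible H) P1"
    unfolding P1_def pairwise_def using AA by blast
  have c20: "pair_compatible H (E, ssum E V0) (U0, H')"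
    using XU[OF p0] XH[OF Xsup[OF p0]] by (auto simp: pair_compatible_def)
  then have c2: "pairwise (pair_compatible H) P2"
    unfolding P2_def pairwise_def using pair_compatible_sym by blast
  have c3': "pair_compatible H (U, ssum E V) (U', ssum E V')"
    if "(U, V) \<in> P" "(U', V') \<in> P" "(U, V) \<noteq> (U', V')" for U V U' V'
    using Pcomp[OF that] lift by (simp add: pair_compatible_def)
  then have c3: "pairwise (pair_compatible H) P3"
    unfolding P3_def pairwise_def by (clarsimp split: prod.splits) blast
  have sXV: "vec.subspace (ssum E V) \<and> vec.dim (ssum E V) + k = vec.dim H \<and> ssum E V \<subseteq> H"
    if "(U, V) \<in> P" for U V
  proof -
    have "E \<inter> V = {0}" using E(4) Pprop(4,6)[OF that] 0 vec.subspace_0 by blast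
    then have "vec.dim (ssum E V) = k + vec.dim V"
      using dim_ssum_Int[OF E(1) Pprop(4)[OF that]] E(5) by simp
    moreover have "ssum E V \<subseteq> H" using Pprop(6)[OF that] E(2) H H'(2) by (intro ssum_subset) auto
    ultimately show ?thesis
      using Pprop(5)[OF that] subspace_ssum[OF E(1) Pprop(4)[OF that]] dim by simp
  qed
  have img: "vec.subspace (A f ` W) \<and> vec.dim (A f ` W) = vec.dim W \<and> A f ` W \<subseteq> H"
    if f: "f \<in> M" and W: "vec.subspace W" "W \<subseteq> H'" for f W
  proof (intro conjI)
    show "vec.subspace (A f ` W)"
      using Alin[OF f] W(1) by (rule vec.linear_subspace_image)
    have "vec.span W \<subseteq> H'" using W H'(1) by (intro vec.span_minimal)
    then show "vec.dim (A f ` W) = vec.dim W"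
      by (intro vec.dim_image_eq Alin[OF f] inj_on_subset[OF Ainj[OF f]])
    show "A f ` W \<subseteq> H"
    proof
      fix y assume "y \<in> A f ` W"
      then obtain x where x: "x \<in> W" "y = pr x + f x" by (auto simp: A_def)
      moreover have "pr x \<in> H" "f x \<in> H" using fH[OF f] W(2) H'(2) E(2) prX x(1) by blast+
      ultimately show "y \<in> H" using vec.subspace_add[OF H] by simp
    qed
  qed
  have fam: "pair_family k H (P1 \<union> P2 \<union> P3)"
    unfolding pair_family_def
  proof
    have "\<forall>(U, V)\<in>P1. vec.subspace U \<and> vec.dim U = k \<and> U \<subseteq> H \<and>
        vec.subspace V \<and> vec.dim V + k = vec.dim H \<and> V \<subseteq> H"
      using img Y H' dim by (auto simp: P1_def)
    moreover have "\<forall>(U, V)\<in>P2. vec.subspace U \<and> vec.dim U = k \<and> U \<subseteq> H \<and>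
        vec.subspace V \<and> vec.dim V + k = vec.dim H \<and> V \<subseteq> H"
      using sXV[OF p0] E Pprop[OF p0] H' dim by (auto simp: P2_def)
    moreover have "\<forall>(U, V)\<in>P3. vec.subspace U \<and> vec.dim U = k \<and> U \<subseteq> H \<and>
        vec.subspace V \<and> vec.dim V + k = vec.dim H \<and> V \<subseteq> H"
    proof -
      have "vec.subspace U \<and> vec.dim U = k \<and> U \<subseteq> H \<and> vec.subspace (ssum E V) \<and>
          vec.dim (ssum E V) + k = vec.dim H \<and> ssum E V \<subseteq> H" if "(U, V) \<in> P" for U V
        using sXV[OF that] Pprop(1-3)[OF that] H'(2) by simp
      then show ?thesis by (auto simp: P3_def)
    qed
    ultimately show "\<forall>(U, V)\<in>P1 \<union> P2 \<union> P3. vec.subspace U \<and> vec.dim U = k \<and> U \<subseteq> H \<and>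
        vec.subspace V \<and> vec.dim V + k = vec.dim H \<and> V \<subseteq> H"
      unfolding ball_Un by (intro conjI)
    show "pairwise (pair_compatible H) (P1 \<union> P2 \<union> P3)"
      by (intro pairwise_Un_symmetric c1 c2 c3) (auto intro: c12 c13 c23 pair_compatible_sym)
  qed
  have neq: "p \<noteq> p'" if "pair_compatible H p p'" "p \<in> P1 \<union> P2 \<union> P3" for p p'
    using that(1) pair_family_dim_fst[OF fam that(2)] k by (intro pair_compatible_neq) simp_all
  have fin: "finite P1" "finite P2" "finite P3"
    using M0(1) P(2) by (auto simp: P1_def P2_def P3_def)
  have "card P1 = card M"
    unfolding P1_def
  proof (rule card_image, rule inj_onI, rule ccontr)
    fix f g assume fg: "f \<in> M" "g \<in> M" "(A f ` Y, A f ` H') = (A g ` Y, A g ` H')" "f \<noteq> g"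
    then show False using neq[OF AA[of f g]] by (auto simp: P1_def)
  qed
  moreover have "card P2 = 2"
    using neq[OF c20] by (simp add: P2_def)
  moreover have "card P3 = card (P - {(U0, V0)})"
    unfolding P3_def
  proof (rule card_image, rule inj_onI, rule ccontr)
    fix p p' assume pp: "p \<in> P - {(U0, V0)}" "p' \<in> P - {(U0, V0)}"
      "(case p of (U, V) \<Rightarrow> (U, ssum E V)) = (case p' of (U, V) \<Rightarrow> (U, ssum E V))" "p \<noteq> p'"
    obtain U V U' V' where [simp]: "p = (U, V)" "p' = (U', V')" by fastforce
    have "(U, ssum E V) \<in> P3" using pp by (force simp: P3_def)
    then show False using pp neq[OF c3'[of U V U' V']] by auto
  qed
  moreover have "P1 \<inter> P2 = {}" "(P1 \<union> P2) \<inter> P3 = {}"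
    using c12 c13 c23 neq by blast+
  moreover have "CARD('a) ^ vec.dim H' > 0" by simp
  moreover have "card P > 0" using P by (simp add: card_gt_0_iff)
  ultimately have card: "card (P1 \<union> P2 \<union> P3) = CARD('a) ^ vec.dim H' + card P"
    using fin M0(2) p0 by (simp add: card_Un_disjoint)
  have "\<forall>(U, V)\<in>P1 \<union> P2. U \<subseteq> V"
    using Y(2) Xsup[OF p0] Pprop(3)[OF p0] by (auto simp: P1_def P2_def)
  moreover have "\<forall>(U, V)\<in>P3. U \<subseteq> V"
  proof (clarsimp simp: P3_def)
    fix U V x assume UV: "(U, V) \<in> P" "U = U0 \<longrightarrow> V \<noteq> V0" "x \<in> U"
    \<comment> \<open>If \<open>P\<close> is a single pair, \<open>P3\<close> is empty and no old
      inclusion is inherited; otherwise \<open>sub\<close> applies.\<close>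
    have "card {(U, V), (U0, V0)} \<le> card P" using UV p0 P(2) by (intro card_mono) auto
    then have "card P > 1" using UV(2) by auto
    then have "U \<subseteq> V" using sub UV by auto
    then show "x \<in> ssum E V" using UV(3) ssum_supset2[of E V] 0 by auto
  qed
  ultimately have "\<forall>(U, V)\<in>P1 \<union> P2 \<union> P3. U \<subseteq> V" by blast
  then show thesis using that fam fin card by blast
qed

text \<open>The step from dimension ik + r to (i+1)k + r adds q^(ik+r) pairs, so L is the sum of
  these powers for 1 \<le> i < m. The equation is its closed form; the upper bound needs it together
  with the divisibility.\<close>

lemma pair_family_exists:
  fixes H :: "('a::{field,finite} ^ 'n::finite) set"
  assumes k: "k > 0" and "vec.subspace H" "vec.dim H = m * k + r" "m \<ge> 1"
  shows "\<exists>P L. pair_family k H P \<and> finite P \<and> card P = L + 1 \<and>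
    L * (CARD('a) ^ k - 1) + CARD('a) ^ (k + r) = CARD('a) ^ vec.dim H \<and> CARD('a) ^ k dvd L \<and>
    (m \<ge> 2 \<longrightarrow> L > 0 \<and> (\<forall>(U, V)\<in>P. U \<subseteq> V))"
  using assms(4,2,3)
proof (induction m arbitrary: H rule: dec_induct)
  case base
  obtain U where U: "vec.subspace U" "U \<subseteq> H" "vec.dim U = k"
    using subspace_of_dim_exists[OF base(1), of k] base(2) by auto
  obtain V where V: "vec.subspace V" "V \<subseteq> H" "vec.dim V = r"
    using subspace_of_dim_exists[OF base(1), of r] base(2) by auto
  \<comment> \<open>One pair, so L = 0 and compatibility is vacuous.\<close>
  show ?case
    using U V base by (intro exI[of _ "{(U, V)}"] exI[of _ 0]) (auto simp: pair_family_def)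
next
  case (step m)
  obtain H' where H': "vec.subspace H'" "H' \<subseteq> H" "vec.dim H' = m * k + r"
    using subspace_of_dim_exists[OF step(4), of "m * k + r"] step(5) by auto
  obtain P L where P: "pair_family k H' P" "finite P" "card P = L + 1"
    "L * (CARD('a) ^ k - 1) + CARD('a) ^ (k + r) = CARD('a) ^ vec.dim H'" "CARD('a) ^ k dvd L"
    "m \<ge> 2 \<longrightarrow> L > 0 \<and> (\<forall>(U, V)\<in>P. U \<subseteq> V)"
    using step(3)[OF H'(1,3)] by blast
  have q: "CARD('a) > 1" by (rule card_field_gt_1)
  have sub: "\<forall>(U, V)\<in>P. U \<subseteq> V" if "card P > 1"
  proof -
    have "m \<noteq> 1"
    proof
      assume "m = 1"
      then have "L * (CARD('a) ^ k - 1) = 0" using P(4) H'(3) by simp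
      moreover have "CARD('a) ^ k > 1" using q k by (intro one_less_power)
      ultimately have "L = 0" by simp
      then show False using that P(3) by simp
    qed
    then show ?thesis using P(6) step(1) by simp
  qed
  have km: "k \<le> vec.dim H'" using H'(3) step(1) by (cases m) auto
  have dH: "vec.dim H = k + vec.dim H'" using H'(3) step(5) by simp
  obtain P' where P': "pair_family k H P'" "finite P'"
    "card P' = CARD('a) ^ vec.dim H' + card P" "\<forall>(U, V)\<in>P'. U \<subseteq> V"
    using pair_family_extend[OF k step(4) H'(1,2) dH km P(1,2) _ sub] P(3)
    by (metis card.empty add_is_0 one_neq_zero)
  define L' where "L' = L + CARD('a) ^ vec.dim H'"
  have "L' * (CARD('a) ^ k - 1) + CARD('a) ^ (k + r) =
      CARD('a) ^ vec.dim H' * (CARD('a) ^ k - 1) + CARD('a) ^ vec.dim H'"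
    unfolding L'_def distrib_right P(4)[symmetric] by simp
  also have "\<dots> = CARD('a) ^ vec.dim H' * ((CARD('a) ^ k - 1) + 1)"
    by (simp only: distrib_left mult_1_right)
  also have "\<dots> = CARD('a) ^ vec.dim H"
    unfolding dH using q by (simp add: power_add)
  finally have 1: "L' * (CARD('a) ^ k - 1) + CARD('a) ^ (k + r) = CARD('a) ^ vec.dim H" .
  have "CARD('a) ^ k dvd L'"
    unfolding L'_def using P(5) km by (intro dvd_add le_imp_power_dvd)
  moreover have "L' > 0" using q by (simp add: L'_def)
  ultimately show ?case
    using P' 1 P(3) by (intro exI[of _ P'] exI[of _ L']) (simp add: L'_def)
qed

section \<open>Optimum distance flag codes\<close>

text \<open>For t < n the condition \<open>t \<le> n div 2\<close> amounts to
  \<open>t \<le> n - t\<close>. Each term is half the largest distance between two t-spaces.\<close>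

lemma max_flag_dist_eq:
  assumes "\<forall>t\<in>set ts. t < n"
  shows "max_flag_dist n ts = 2 * (\<Sum>t\<in>set ts. min t (n - t))"
proof -
  have "(\<Sum>t\<in>set ts. min t (n - t)) =
      (\<Sum>t\<in>{t \<in> set ts. t \<le> n div 2}. min t (n - t)) + (\<Sum>t\<in>{t \<in> set ts. t > n div 2}. min t (n - t))"
    by (subst sum.union_disjoint[symmetric]) (auto intro!: sum.cong)
  also have "(\<Sum>t\<in>{t \<in> set ts. t \<le> n div 2}. min t (n - t)) = (\<Sum>t\<in>{t \<in> set ts. t \<le> n div 2}. t)"
    by (rule sum.cong) auto
  also have "(\<Sum>t\<in>{t \<in> set ts. t > n div 2}. min t (n - t)) = (\<Sum>t\<in>{t \<in> set ts. t > n div 2}. n - t)"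
    by (rule sum.cong) auto
  finally show ?thesis by (simp add: max_flag_dist_def)
qed

lemma max_flag_dist_conv_nth:
  assumes "flag_type n ts"
  shows "int (max_flag_dist n ts) = (\<Sum>i<length ts. 2 * int (min (ts ! i) (n - ts ! i)))"
proof -
  have "distinct ts"
    using assms by (simp add: flag_type_def strict_sorted_iff)
  then have "bij_betw ((!) ts) {..<length ts} (set ts)"
    by (rule bij_betw_nth) auto
  then have "(\<Sum>t\<in>set ts. min t (n - t)) = (\<Sum>i<length ts. min (ts ! i) (n - ts ! i))"
    by (simp add: sum.reindex_bij_betw[symmetric])
  moreover have "max_flag_dist n ts = 2 * (\<Sum>t\<in>set ts. min t (n - t))"
    using assms by (intro max_flag_dist_eq) (simp add: flag_type_def)
  ultimately show ?thesis by (simp add: sum_distrib_left)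
qed

lemma dim_UNIV_vec: "vec.dim (UNIV :: ('a::field ^ 'n::finite) set) = CARD('n)"
  by (rule vec_dim_card)

lemma dim_le_CARD: "vec.dim (U :: ('a::field ^ 'n::finite) set) \<le> CARD('n)"
  using vec.dim_subset[of U UNIV] unfolding dim_UNIV_vec by simp

lemma dim_Int_ge:
  fixes U V :: "('a::field ^ 'n::finite) set"
  assumes "vec.subspace U" "vec.subspace V"
  shows "vec.dim U + vec.dim V \<le> CARD('n) + vec.dim (U \<inter> V)"
  using dim_ssum_Int[OF assms] dim_le_CARD[of "ssum U V"] by linarith

lemma subspace_dist_le:
  fixes U V :: "('a::field ^ 'n::finite) set"
  assumes "vec.subspace U" "vec.subspace V" "vec.dim U = t" "vec.dim V = t"
  shows "subspace_dist U V \<le> 2 * int (min t (CARD('n) - t))"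
  using dim_Int_ge[OF assms(1,2)] assms(3,4) dim_le_CARD[of U]
  by (auto simp: subspace_dist_def min_def)

text \<open>The bounds of \<open>subspace_dist_le\<close> add up to \<open>max_flag_dist\<close>. A
  sum that reaches the sum of its termwise bounds reaches each of them.\<close>

lemma odfc_subspace_dist:
  fixes C :: "('a::{field,finite} ^ 'n::finite) set list set"
  assumes C: "odfc ts C" "F \<in> C" "F' \<in> C" "F \<noteq> F'" and i: "i < length ts"
  shows "subspace_dist (F ! i) (F' ! i) = 2 * int (min (ts ! i) (CARD('n) - ts ! i))"
proof -
  have flag: "is_flag ts F" "is_flag ts F'" and "C \<subseteq> {F. is_flag ts F}"
    using C by (auto simp: odfc_def flag_code_def)
  then have fin: "finite C" using finite_flags finite_subset by blast
  have "{flag_dist F F' |F F'. F \<in> C \<and> F' \<in> C \<and> F \<noteq> F'} \<subseteq> (\<lambda>(F, F'). flag_dist F F') ` (C \<times> C)"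
    by auto
  then have fin2: "finite {flag_dist F F' |F F'. F \<in> C \<and> F' \<in> C \<and> F \<noteq> F'}"
    by (rule finite_subset) (use fin in auto)
  have "code_min_dist C = Min {flag_dist F F' |F F'. F \<in> C \<and> F' \<in> C \<and> F \<noteq> F'}"
    unfolding code_min_dist_def using C by (subst if_P) auto
  also have "\<dots> \<le> flag_dist F F'"
    by (rule Min_le[OF fin2]) (use C in auto)
  finally have "int (max_flag_dist CARD('n) ts) \<le> flag_dist F F'"
    using C(1) by (simp add: odfc_def)
  moreover have "flag_dist F F' = (\<Sum>i<length ts. subspace_dist (F ! i) (F' ! i))"
    using flag by (simp add: flag_dist_def is_flag_def)
  moreover have le: "subspace_dist (F ! i) (F' ! i) \<le> 2 * int (min (ts ! i) (CARD('n) - ts ! i))"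
    if "i < length ts" for i
    using flag that by (intro subspace_dist_le) (auto simp: is_flag_def)
  then have "(\<Sum>i<length ts. subspace_dist (F ! i) (F' ! i)) \<le>
      (\<Sum>i<length ts. 2 * int (min (ts ! i) (CARD('n) - ts ! i)))"
    by (intro sum_mono) simp
  moreover have "int (max_flag_dist CARD('n) ts) =
      (\<Sum>i<length ts. 2 * int (min (ts ! i) (CARD('n) - ts ! i)))"
    using flag(1) by (intro max_flag_dist_conv_nth) (simp add: is_flag_def)
  ultimately have "(\<Sum>i<length ts. subspace_dist (F ! i) (F' ! i)) =
      (\<Sum>i<length ts. 2 * int (min (ts ! i) (CARD('n) - ts ! i)))"
    by linarith
  then show ?thesis
    by (rule sum_mono_inv) (use le i in auto)
qed

section \<open>From codes to partial spreads, and back\<close>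

lemma dim_perp:
  fixes U :: "('a::{field,finite} ^ 'n::finite) set"
  assumes "vec.subspace U"
  shows "vec.dim (perp U) + vec.dim U = CARD('n)"
proof -
  have "CARD('a) ^ (vec.dim (perp U) + vec.dim U) = CARD('a) ^ CARD('n)"
    using card_perp[OF assms] by (simp only: card_subspace[OF assms] card_subspace[OF subspace_perp] power_add)
  then show ?thesis using card_field_gt_1[where 'a = 'a] by (simp add: power_inject_exp)
qed

lemma perp_Int_perp:
  fixes U V :: "('a::field ^ 'n::finite) set"
  assumes "ssum U V = UNIV"
  shows "perp U \<inter> perp V = {0}"
proof -
  have "a = 0" if a: "a \<in> perp U" "a \<in> perp V" for a
  proof (rule ccontr)
    assume "a \<noteq> 0"
    then obtain y where y: "dot a y \<noteq> 0" by (rule dot_nonzero)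
    have "y \<in> ssum U V" using assms by simp
    then obtain u v where "u \<in> U" "v \<in> V" "y = u + v" by (auto simp: ssum_def)
    then show False using y a by (simp add: dot_add perp_def)
  qed
  then show ?thesis by (auto simp: zero_in_perp)
qed

lemma subspace_eq_UNIV:
  fixes U :: "('a::field ^ 'n::finite) set"
  assumes "vec.subspace U" "vec.dim U = CARD('n)"
  shows "U = UNIV"
  by (rule vec.subspace_dim_equal[OF assms(1) vec.subspace_UNIV subset_UNIV])
    (simp only: dim_UNIV_vec assms(2) order_refl)

lemma odfc_card_le:
  fixes C :: "('a::{field,finite} ^ 'n::finite) set list set"
  assumes C: "odfc ts C" and t: "t \<in> set ts" "t = k \<or> t + k = CARD('n)"
    and k: "k > 0" "2 * k \<le> CARD('n)"
    and L: "L * (CARD('a) ^ k - 1) + CARD('a) ^ (k + r) = CARD('a) ^ CARD('n)"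
    and dvd: "CARD('a) ^ k dvd L" and r: "(\<Sum>i<r. CARD('a) ^ i) < k"
  shows "card C \<le> L + 1"
proof -
  obtain i where i: "i < length ts" "ts ! i = t" using t(1) by (auto simp: in_set_conv_nth)
  have sub: "vec.subspace (F ! i)" "vec.dim (F ! i) = t" if "F \<in> C" for F
    using C that i by (auto simp: odfc_def flag_code_def is_flag_def)
  define h where "h F = (if t = k then F ! i else perp (F ! i))" for F :: "('a ^ 'n) set list"
  have h: "vec.subspace (h F)" "vec.dim (h F) = k" if "F \<in> C" for F
    using sub[OF that] t(2) dim_perp[of "F ! i"] by (auto simp: h_def subspace_perp)
  have disj: "h F \<inter> h F' = {0}" if F: "F \<in> C" "F' \<in> C" "F \<noteq> F'" for F F'
  proof -
    have "min t (CARD('n) - t) = k" using t(2) k by auto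
    then have d: "subspace_dist (F ! i) (F' ! i) = 2 * int k"
      using odfc_subspace_dist[OF C F i(1)] i(2) by simp
    show ?thesis
    proof (cases "t = k")
      case True
      then have "vec.dim (F ! i \<inter> F' ! i) = 0"
        using d sub F by (simp add: subspace_dist_def)
      then have "F ! i \<inter> F' ! i = {0}"
        using sub(1)[OF F(1)] sub(1)[OF F(2)] vec.subspace_0 by auto
      then show ?thesis using True by (simp add: h_def)
    next
      case False
      \<comment> \<open>Now t = n - k, and distance 2k means an intersection of dimension n - 2k, so
        the sum has dimension 2(n - k) - (n - 2k) = n.\<close>
      then have "vec.dim (ssum (F ! i) (F' ! i)) = CARD('n)"
        using d sub[OF F(1)] sub[OF F(2)] t(2) dim_ssum_Int[of "F ! i" "F' ! i"]
        by (simp add: subspace_dist_def)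
      then have "ssum (F ! i) (F' ! i) = UNIV"
        using sub[OF F(1)] sub[OF F(2)] by (intro subspace_eq_UNIV subspace_ssum)
      then show ?thesis using False perp_Int_perp by (simp add: h_def)
    qed
  qed
  have "inj_on h C"
  proof (rule inj_onI, rule ccontr)
    fix F F' assume F: "F \<in> C" "F' \<in> C" "h F = h F'" "F \<noteq> F'"
    then have "h F = {0}" using disj[of F F'] by simp
    then show False using h(2)[OF F(1)] k(1) by simp
  qed
  then have "card C = card (h ` C)" by (simp add: card_image)
  also have "\<dots> \<le> L + 1"
  proof (rule partial_spread_card_le[OF _ _ _ k(1) L dvd r])
    show "vec.subspace U" "vec.dim U = k" if "U \<in> h ` C" for U using that h by auto
    show "U \<inter> V = {0}" if UV: "U \<in> h ` C" "V \<in> h ` C" "U \<noteq> V" for U V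
    proof -
      obtain F F' where F: "F \<in> C" "F' \<in> C" "U = h F" "V = h F'" using UV by blast
      then show ?thesis using disj[of F F'] UV(3) by blast
    qed
  qed
  finally show ?thesis .
qed

text \<open>Join a chain from 0 to \<open>U\<close> with a chain from \<open>V\<close> to the whole
  space; across the gap, monotonicity passes through \<open>U \<subseteq> V\<close>.\<close>

lemma flag_through_pair:
  fixes U V :: "('a::field ^ 'n::finite) set"
  assumes U: "vec.subspace U" "vec.dim U = k" and V: "vec.subspace V" "vec.dim V + k = CARD('n)"
    and UV: "U \<subseteq> V" and k: "2 * k \<le> CARD('n)"
  shows "\<exists>g. (\<forall>t\<in>{0..k} \<union> {CARD('n) - k..CARD('n)}. vec.subspace (g t) \<and> vec.dim (g t) = t \<and>
        (t \<le> k \<longrightarrow> g t \<subseteq> U) \<and> (t > k \<longrightarrow> V \<subseteq> g t)) \<and>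
      (\<forall>s\<in>{0..k} \<union> {CARD('n) - k..CARD('n)}. \<forall>t\<in>{0..k} \<union> {CARD('n) - k..CARD('n)}.
        s \<le> t \<longrightarrow> g s \<subseteq> g t)"
proof -
  have z: "vec.subspace {0 :: 'a ^ 'n}" "{0} \<subseteq> U" "vec.dim {0 :: 'a ^ 'n} = 0"
    using U(1) vec.subspace_0 by (auto simp: vec.subspace_single_0)
  obtain G where G: "\<And>t. t \<le> k \<Longrightarrow> vec.subspace (G t) \<and> vec.dim (G t) = t \<and> G t \<subseteq> U"
    "\<And>s t. s \<le> t \<Longrightarrow> G s \<subseteq> G t"
    using subspace_chain_exists[OF z(1) U(1) z(2)] z(3) U(2) by (metis le0)
  obtain G' where G': "\<And>t. CARD('n) - k \<le> t \<Longrightarrow> t \<le> CARD('n) \<Longrightarrow>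
      vec.subspace (G' t) \<and> vec.dim (G' t) = t \<and> V \<subseteq> G' t" "\<And>s t. s \<le> t \<Longrightarrow> G' s \<subseteq> G' t"
    using subspace_chain_exists[OF V(1) vec.subspace_UNIV subset_UNIV] V(2)
    unfolding dim_UNIV_vec by (metis diff_add_inverse2)
  \<comment> \<open>For n = 2k both ranges contain k; the first chain then decides.\<close>
  define g where "g t = (if t \<le> k then G t else G' t)" for t
  have 1: "vec.subspace (g t) \<and> vec.dim (g t) = t \<and> (t \<le> k \<longrightarrow> g t \<subseteq> U) \<and> (t > k \<longrightarrow> V \<subseteq> g t)"
    if "t \<in> {0..k} \<union> {CARD('n) - k..CARD('n)}" for t
    using that G(1)[of t] G'(1)[of t] by (auto simp: g_def)
  moreover have "g s \<subseteq> g t"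
    if "s \<in> {0..k} \<union> {CARD('n) - k..CARD('n)}" "t \<in> {0..k} \<union> {CARD('n) - k..CARD('n)}" "s \<le> t" for s t
  proof (cases "s \<le> k \<and> t > k")
    case True
    then show ?thesis using 1[OF that(1)] 1[OF that(2)] UV by blast
  next
    case False
    then show ?thesis using that(3) G(2) G'(2) by (auto simp: g_def)
  qed
  ultimately show ?thesis by blast
qed

text \<open>The resulting code is equidistant. Two pairs are demanded because
  \<open>code_min_dist\<close> is 0 by convention on a single flag, whereas
  \<open>max_flag_dist\<close> is positive for a nonempty type.\<close>

lemma odfc_exists:
  fixes P :: "(('a::{field,finite} ^ 'n::finite) set \<times> ('a ^ 'n) set) set"
  assumes P: "pair_family k UNIV P" "finite P" "card P \<ge> 2" "\<forall>(U, V)\<in>P. U \<subseteq> V"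
    and k: "k > 0" "2 * k \<le> CARD('n)"
    and ts: "flag_type CARD('n) ts" "ts \<noteq> []"
      "set ts \<subseteq> {1..k} \<union> {CARD('n) - k..CARD('n) - 1}"
  shows "\<exists>C :: ('a ^ 'n) set list set. odfc ts C \<and> card C = card P"
proof -
  let ?T = "{0..k} \<union> {CARD('n) - k..CARD('n)}"
  have tsT: "t \<in> ?T" if "t \<in> set ts" for t using subsetD[OF ts(3) that] by auto
  define Q where "Q p g \<longleftrightarrow> (\<forall>t\<in>?T. vec.subspace (g t) \<and> vec.dim (g t) = t \<and>
        (t \<le> k \<longrightarrow> g t \<subseteq> fst p) \<and> (t > k \<longrightarrow> snd p \<subseteq> g t)) \<and>
      (\<forall>s\<in>?T. \<forall>t\<in>?T. s \<le> t \<longrightarrow> g s \<subseteq> g t)" for p :: "('a ^ 'n) set \<times> ('a ^ 'n) set" and g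
  have "\<exists>g. Q p g" if p: "p \<in> P" for p
  proof -
    obtain U V where UV: "p = (U, V)" by fastforce
    have "vec.subspace U" "vec.dim U = k" "vec.subspace V" "vec.dim V + k = CARD('n)" "U \<subseteq> V"
      using P(1,4) p unfolding UV pair_family_def dim_UNIV_vec by auto
    then show ?thesis
      using flag_through_pair[OF _ _ _ _ _ k(2)] unfolding Q_def UV fst_conv snd_conv by blast
  qed
  then have "\<forall>p\<in>P. \<exists>g. Q p g" by blast
  then obtain g where Q: "\<forall>p\<in>P. Q p (g p)" by (rule bchoice[THEN exE])
  have g: "\<And>p t. p \<in> P \<Longrightarrow> t \<in> ?T \<Longrightarrow> vec.subspace (g p t) \<and> vec.dim (g p t) = t \<and>
        (t \<le> k \<longrightarrow> g p t \<subseteq> fst p) \<and> (t > k \<longrightarrow> snd p \<subseteq> g p t)"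
    and mono: "\<And>p s t. p \<in> P \<Longrightarrow> s \<in> ?T \<Longrightarrow> t \<in> ?T \<Longrightarrow> s \<le> t \<Longrightarrow> g p s \<subseteq> g p t"
    using Q unfolding Q_def by blast+
  define Fl where "Fl p = map (g p) ts" for p
  have flag: "is_flag ts (Fl p)" if p: "p \<in> P" for p
    unfolding is_flag_def
  proof (intro conjI allI impI)
    have "sorted_wrt (\<lambda>s t. g p s \<subset> g p t) ts"
    proof (rule sorted_wrt_mono_rel)
      show "sorted_wrt (<) ts" using ts(1) by (simp add: flag_type_def)
      fix s t assume st: "s \<in> set ts" "t \<in> set ts" "s < t"
      then have "g p s \<subseteq> g p t" using mono[OF p] tsT by simp
      moreover have "vec.dim (g p s) \<noteq> vec.dim (g p t)"
        using g[OF p tsT[OF st(1)]] g[OF p tsT[OF st(2)]] st(3) by simp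
      ultimately show "g p s \<subset> g p t" by auto
    qed
    then show "sorted_wrt (\<subset>) (Fl p)" by (simp add: Fl_def sorted_wrt_map)
  qed (use ts(1) g[OF p tsT] in \<open>auto simp: Fl_def\<close>)
  have dist: "flag_dist (Fl p) (Fl p') = int (max_flag_dist CARD('n) ts)"
    if p: "p \<in> P" "p' \<in> P" "p \<noteq> p'" for p p'
  proof -
    have comp: "fst p \<inter> fst p' = {0}" "ssum (snd p) (snd p') = UNIV"
    proof -
      have "pairwise (pair_compatible UNIV) P" using P(1) by (simp add: pair_family_def)
      then have "pair_compatible UNIV p p'" using p by (rule pairwiseD)
      then show "fst p \<inter> fst p' = {0}" "ssum (snd p) (snd p') = UNIV"
        by (simp_all add: pair_compatible_def top_unique)
    qed
    have "subspace_dist (g p t) (g p' t) = 2 * int (min t (CARD('n) - t))" if t: "t \<in> set ts" for t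
    proof (cases "t \<le> k")
      case True
      then have "g p t \<inter> g p' t \<subseteq> {0}"
        using g[OF p(1) tsT[OF t]] g[OF p(2) tsT[OF t]] comp(1) by blast
      then have "vec.dim (g p t \<inter> g p' t) = 0" by simp
      then show ?thesis
        using g[OF p(1) tsT[OF t]] g[OF p(2) tsT[OF t]] True k by (simp add: subspace_dist_def)
    next
      case False
      have "UNIV \<subseteq> ssum (g p t) (g p' t)"
        using g[OF p(1) tsT[OF t]] g[OF p(2) tsT[OF t]] False
        unfolding comp(2)[symmetric] ssum_def by (auto simp: not_le)
      then have "ssum (g p t) (g p' t) = UNIV" by blast
      then have "CARD('n) + vec.dim (g p t \<inter> g p' t) = t + t"
        using dim_ssum_Int[of "g p t" "g p' t"] g[OF p(1) tsT[OF t]] g[OF p(2) tsT[OF t]]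
        by (simp add: card_cart_basis)
      moreover have "t < CARD('n)" using ts(1) t by (simp add: flag_type_def)
      moreover have "CARD('n) - k \<le> t" using subsetD[OF ts(3) t] False by auto
      moreover have "min t (CARD('n) - t) = CARD('n) - t" using calculation k(2) by linarith
      moreover have "vec.dim (g p t) = t" "vec.dim (g p' t) = t"
        using g[OF p(1) tsT[OF t]] g[OF p(2) tsT[OF t]] by auto
      ultimately show ?thesis
        unfolding subspace_dist_def by linarith
    qed
    then have "flag_dist (Fl p) (Fl p') = (\<Sum>i<length ts. 2 * int (min (ts ! i) (CARD('n) - ts ! i)))"
      by (simp add: flag_dist_def Fl_def)
    then show ?thesis using max_flag_dist_conv_nth[OF ts(1)] by simp
  qed
  have "0 < (\<Sum>t\<in>set ts. min t (CARD('n) - t))"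
    by (rule sum_pos) (use ts in \<open>auto simp: flag_type_def\<close>)
  then have pos: "max_flag_dist CARD('n) ts > 0"
    using max_flag_dist_eq[of ts "CARD('n)"] ts(1) by (simp add: flag_type_def)
  have neq: "Fl p \<noteq> Fl p'" if "p \<in> P" "p' \<in> P" "p \<noteq> p'" for p p'
  proof
    assume "Fl p = Fl p'"
    then have "flag_dist (Fl p) (Fl p') = 0" by (simp add: flag_dist_def subspace_dist_def)
    then show False using dist[OF that] pos by simp
  qed
  then have "inj_on Fl P" by (meson inj_onI)
  then have card: "card (Fl ` P) = card P" by (rule card_image)
  obtain p p' where pp: "p \<in> P" "p' \<in> P" "p \<noteq> p'"
    using P(2,3) by (metis card_le_Suc0_iff_eq not_less_eq_eq numeral_2_eq_2)
  have "{flag_dist F F' |F F'. F \<in> Fl ` P \<and> F' \<in> Fl ` P \<and> F \<noteq> F'} = {int (max_flag_dist CARD('n) ts)}"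
    (is "?D = _")
  proof
    show "?D \<subseteq> {int (max_flag_dist CARD('n) ts)}" using dist by auto
    have "flag_dist (Fl p) (Fl p') \<in> ?D" using pp neq[OF pp] by blast
    then show "{int (max_flag_dist CARD('n) ts)} \<subseteq> ?D" using dist[OF pp] by simp
  qed
  moreover have "\<exists>F\<in>Fl ` P. \<exists>F'\<in>Fl ` P. F \<noteq> F'" using pp neq[OF pp] by blast
  ultimately have "code_min_dist (Fl ` P) = int (max_flag_dist CARD('n) ts)"
    unfolding code_min_dist_def by simp
  moreover have "flag_code ts (Fl ` P)" using flag pp by (auto simp: flag_code_def)
  ultimately show ?thesis using card by (auto simp: odfc_def)
qed

theorem corollary3p2:
  fixes q n k r :: nat and A :: "nat set"
  assumes "q = CARD('a::{field,finite})" and "n = CARD('n::finite)"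
    and "k > 0" and "n \<ge> 2 * k"
    and "A \<subseteq> {1..k} \<union> {n - k..n - 1}" and "A \<inter> {k, n - k} \<noteq> {}"
    and "[n = r] (mod k)" and "r < k"
    and "real k > (real q ^ r - 1) / (real q - 1)"
  shows "real (max_odfc_card TYPE('a) TYPE('n) A) =
           (real q ^ n - real q ^ (k + r)) / (real q ^ k - 1) + 1"
proof -
  define ts where "ts = sorted_list_of_set A"
  have q: "q > 1" using card_field_gt_1[where 'a = 'a] assms(1) by simp
  have "finite A" using assms(5) finite_subset by blast
  then have set_ts: "set ts = A" by (simp add: ts_def)
  have "0 < t \<and> t < CARD('n)" if "t \<in> A" for t
    using subsetD[OF assms(5) that] assms(2-4) by auto
  then have ts: "flag_type CARD('n) ts"
    unfolding flag_type_def set_ts by (auto simp: ts_def)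
  have theta: "(\<Sum>i<r. CARD('a) ^ i) < k"
  proof -
    have "real (\<Sum>i<r. q ^ i) = (real q ^ r - 1) / (real q - 1)"
      using q by (simp add: geometric_sum)
    then have "real (\<Sum>i<r. q ^ i) < real k" using assms(9) by simp
    then show ?thesis using assms(1) by (simp only: of_nat_less_iff)
  qed
  have "n mod k = r" using assms(7,8) by (simp add: cong_def)
  then have "n = n div k * k + r" using div_mult_mod_eq[of n k] by simp
  \<comment> \<open>Quotient at least 2 means at least one inductive step: this gives the inclusions
    and L > 0, hence two pairs.\<close>
  moreover have m: "n div k \<ge> 2" using assms(3,4) by (simp add: less_eq_div_iff_mult_less_eq)
  ultimately obtain P :: "(('a ^ 'n) set \<times> ('a ^ 'n) set) set" and L where
    P: "pair_family k UNIV P" "finite P" "card P = L + 1"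
    and L: "L * (CARD('a) ^ k - 1) + CARD('a) ^ (k + r) = CARD('a) ^ CARD('n)"
      "CARD('a) ^ k dvd L" "L > 0"
    and sub: "\<forall>(U, V)\<in>P. U \<subseteq> V"
    using pair_family_exists[OF assms(3), of "UNIV :: ('a ^ 'n) set" "n div k" r] assms(2)
    unfolding dim_UNIV_vec by (auto simp: vec.subspace_UNIV)
  obtain t where t: "t \<in> A" "t = k \<or> t + k = CARD('n)" using assms(2,4,6) by auto
  have "\<exists>C :: ('a ^ 'n) set list set. odfc ts C \<and> card C = card P"
    by (rule odfc_exists[OF P(1,2) _ sub assms(3) _ ts])
      (use P(3) L(3) assms(2,4,5) t(1) set_ts in auto)
  then obtain C :: "('a ^ 'n) set list set" where C: "odfc ts C" "card C = L + 1"
    using P(3) by auto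
  have "card C' \<le> L + 1" if "odfc ts C'" for C' :: "('a ^ 'n) set list set"
    using odfc_card_le[OF that _ t(2) assms(3) _ L(1,2) theta] t(1) set_ts assms(2,4) by simp
  then have "max_odfc_card TYPE('a) TYPE('n) A = L + 1"
    unfolding max_odfc_card_def ts_def[symmetric]
    by (intro Max_eqI finite_odfc_cards) (use C in \<open>auto intro!: exI[of _ C]\<close>)
  moreover have "real L = (real q ^ n - real q ^ (k + r)) / (real q ^ k - 1)"
  proof -
    have qk: "q ^ k > 1" using q assms(3) by (intro one_less_power)
    have "real (L * (q ^ k - 1) + q ^ (k + r)) = real (q ^ n)"
      using L(1) assms(1,2) by simp
    then have "real L * (real q ^ k - 1) + real q ^ (k + r) = real q ^ n"
      using qk by (simp add: of_nat_diff)
    moreover have "real q ^ k > 1" using qk by (metis of_nat_1 of_nat_less_iff of_nat_power)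
    ultimately show ?thesis by (simp add: field_simps)
  qed
  ultimately show ?thesis by simp
qed

end
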